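(* Let $a,b\ge1$ be integers and $n=a+b$, and suppose the maximal parabolic subalgebra $\mathfrak p(a,b)\subset\mathfrak{sl}_n$ is Frobenius, with principal element $\widehat F$. Then the grading $\mathfrak{gl}_n=\bigoplus_{\lambda\in\mathbb Z}\mathfrak g_\lambda$, where $\mathfrak g_\lambda=\{x\in\mathfrak{gl}_n : [\widehat F,x]=\lambda x\}$, is a good grading.
   Context: Work over $\mathbb C$. $\mathfrak p(a,b)$ is the subalgebra of $\mathfrak{sl}_n$ of trace-zero matrices $X$ with $X_{i,j}=0$ for $i>a$, $j\le a$. It is Frobenius, meaning the form $B_F(x,y)=F([x,y])$ is non-degenerate for some $F\in\mathfrak p(a,b)^*$, if and only if $\gcd(a,b)=1$. The meander $M_{a,b}$ is the directed graph on $\{1,\dots,n\}$ with edges $i\to n+1-i$ for $1\le i<n+1-i$; edges $a+1-i\to i$ for $1\le i<a+1-i$; and edges $n+1-i\to a+i$ for $i\ge1$ with $a+i<n+1-i$. The functional used is $F=\sum_{(i,j)}e_{i,j}^*$, the sum over all edges $i\to j$ of $M_{a,b}$, where $e_{i,j}^*(X)=X_{i,j}$; it is known to be a Frobenius functional when $\gcd(a,b)=1$. The principal element $\widehat F\in\mathfrak p(a,b)$ is the unique element with $F(y)=F([\widehat F,y])$ for all $y\in\mathfrak p(a,b)$. It is known that every matrix unit $e_{i,j}$ is an eigenvector of $\operatorname{ad}_{\widehat F}$ with integer eigenvalue. Good grading (with the convention of rescaled even good gradings, in which the degrees of an even good grading in the sense of Elashvili–Kac are divided by $2$): a $\mathbb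 Z$-grading $\mathfrak g=\bigoplus_{j\in\mathbb Z}\mathfrak g_j$ is good if there is $e\in\mathfrak g_1$ such that $\operatorname{ad}_e:\mathfrak g_j\to\mathfrak g_{j+1}$ is injective for all $j\le-1$ and surjective for all $j\ge0$. *)

theory Defs
  imports Complex_Main "Jordan_Normal_Form.Matrix"
begin

definition bracket :: "complex mat \<Rightarrow> complex mat \<Rightarrow> complex mat" where
  "bracket x y = x * y - y * x"

definition sl :: "nat \<Rightarrow> complex mat set" where
  "sl n = {X \<in> carrier_mat n n. (\<Sum>i<n. X $$ (i, i)) = 0}"

(* Matrix indices of the library start at 0, so rows i > a and columns j <= a
   of the 1-based description become a <= i and j < a. *)
definition parabolic :: "nat \<Rightarrow> nat \<Rightarrow> complex mat set" where
  "parabolic a b =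
     {X \<in> sl (a + b). \<forall>i<a + b. \<forall>j<a + b. a \<le> i \<and> j < a \<longrightarrow> X $$ (i, j) = 0}"

definition linear_functional_on :: "complex mat set \<Rightarrow> (complex mat \<Rightarrow> complex) \<Rightarrow> bool" where
  "linear_functional_on V F \<longleftrightarrow>
     (\<forall>x\<in>V. \<forall>y\<in>V. F (x + y) = F x + F y) \<and> (\<forall>c. \<forall>x\<in>V. F (c \<cdot>\<^sub>m x) = c * F x)"

(* The form (x, y) \<mapsto> F [x, y] is alternating, so triviality of its left radical on the
   finite-dimensional algebra g is non-degeneracy. *)
definition frobenius_functional :: "nat \<Rightarrow> complex mat set \<Rightarrow> (complex mat \<Rightarrow> complex) \<Rightarrow> bool" where
  "frobenius_functional n g F \<longleftrightarrow> linear_functional_on g F \<and>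
     (\<forall>x\<in>g. (\<forall>y\<in>g. F (bracket x y) = 0) \<longrightarrow> x = 0\<^sub>m n n)"

definition frobenius_algebra :: "nat \<Rightarrow> complex mat set \<Rightarrow> bool" where
  "frobenius_algebra n g \<longleftrightarrow> (\<exists>F. frobenius_functional n g F)"

(* Vertices are 1, ..., a + b. No edge occurs twice: edges of the first family increase, those of
   the other two decrease and live on {1..a} and {a+1..a+b} respectively. *)
definition meander_edges :: "nat \<Rightarrow> nat \<Rightarrow> (nat \<times> nat) set" where
  "meander_edges a b =
     {(i, a + b + 1 - i) | i. 1 \<le> i \<and> i < a + b + 1 - i} \<union>
     {(a + 1 - i, i) | i. 1 \<le> i \<and> i < a + 1 - i} \<union>
     {(a + b + 1 - i, a + i) | i. 1 \<le> i \<and> a + i < a + b + 1 - i}"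

lemma meander_edges_subset: "meander_edges a b \<subseteq> {1..a + b} \<times> {1..a + b}"
  unfolding meander_edges_def by auto

lemma finite_meander_edges: "finite (meander_edges a b)"
  by (rule finite_subset[OF meander_edges_subset]) simp

(* The shift by 1 converts vertices to 0-based matrix indices. *)
definition meander_functional :: "nat \<Rightarrow> nat \<Rightarrow> complex mat \<Rightarrow> complex" where
  "meander_functional a b X = (\<Sum>(i, j)\<in>meander_edges a b. X $$ (i - 1, j - 1))"

(* For a Frobenius functional F on g there is exactly one such h. *)
definition is_principal_element ::
  "complex mat set \<Rightarrow> (complex mat \<Rightarrow> complex) \<Rightarrow> complex mat \<Rightarrow> bool" where
  "is_principal_element g F h \<longleftrightarrow> h \<in> g \<and> (\<forall>y\<in>g. F y = F (bracket h y))"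

definition mat_subspace :: "nat \<Rightarrow> complex mat set \<Rightarrow> bool" where
  "mat_subspace n V \<longleftrightarrow> V \<subseteq> carrier_mat n n \<and> 0\<^sub>m n n \<in> V \<and>
     (\<forall>x\<in>V. \<forall>y\<in>V. x + y \<in> V) \<and> (\<forall>c. \<forall>x\<in>V. c \<cdot>\<^sub>m x \<in> V)"

(* The third conjunct says that gl_n is the direct sum of the G j: each x has exactly one
   decomposition into homogeneous components f j, almost all of them zero. The sum is written
   entrywise, since matrices of fixed size form no type. *)
definition gl_grading :: "nat \<Rightarrow> (int \<Rightarrow> complex mat set) \<Rightarrow> bool" where
  "gl_grading n G \<longleftrightarrow>
     (\<forall>j. mat_subspace n (G j)) \<and>
     (\<forall>i j. \<forall>x\<in>G i. \<forall>y\<in>G j. bracket x y \<in> G (i + j)) \<and>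
     (\<forall>x\<in>carrier_mat n n. \<exists>!f. (\<forall>j. f j \<in> G j) \<and> finite {j. f j \<noteq> 0\<^sub>m n n} \<and>
        x = mat n n (\<lambda>(p, q). \<Sum>j | f j \<noteq> 0\<^sub>m n n. f j $$ (p, q)))"

(* Degrees are normalised so that e has degree 1, i.e. they are half of those of an even good
   grading in the sense of Elashvili and Kac. *)
definition good_grading :: "nat \<Rightarrow> (int \<Rightarrow> complex mat set) \<Rightarrow> bool" where
  "good_grading n G \<longleftrightarrow> gl_grading n G \<and>
     (\<exists>e\<in>G 1. (\<forall>j\<le>-1. inj_on (bracket e) (G j)) \<and> (\<forall>j\<ge>0. bracket e ` G j = G (j + 1)))"

definition ad_eigenspace :: "nat \<Rightarrow> complex mat \<Rightarrow> int \<Rightarrow> complex mat set" where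
  "ad_eigenspace n h k = {x \<in> carrier_mat n n. bracket h x = of_int k \<cdot>\<^sub>m x}"

end

theory Submission
  imports Defs
begin

text \<open>
  Evaluating $F(y) = F([\hat F, y])$ on matrix units gives linear equations for the entries of $\hat F$. If
  $a < b$, these equations for $(a, b)$ restrict to the equations for $(a, b - a)$ on the lower diagonal block,
  and determine the rest of $\hat F$ from that block. Descending by Euclid's algorithm, one finds that
  $\hat F$ is diagonal, and that the generating functions $(p, q)$ of its eigenvalues on the two blocks are obtained
  from $(z, 1)$ by the steps $(p, q) \mapsto (z p, p + q)$ and $(p, q) \mapsto (p + q, z^{-1} q)$, up to a shift.

  A diagonal matrix with eigenvalues in a coset of the integers induces a good grading as soon as the eigenvalue
  multiplicities are unimodal: arrange the basis vectors in a pyramid with one column for each eigenvalue, and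
  let $e$ shift each row by one box.

  So $p + q$ has to be unimodal. The coefficients are shown to be interlaced about their centre, which is
  stronger: for a word $X$ of degree $k$ with matrix $(a, b; c, d)$, and $T = p + q$, the palindromic identities give
  $T - z^k \tilde T = - z^{-1} (d - z^{k + 2} \tilde d)$, $T - z^{k + 2} \tilde T = - z^2 (a - z^{k - 2} \tilde a)$ and
  $T - z^{k + 1} \tilde T = b - z^{k + 1} \tilde b$, while $a$, $d$ and $b$ are, up to shifts, built from the
  polynomials $T$ of shorter words, so that the signs of the right-hand sides are known by induction.
\<close>

section \<open>Words and the unimodality of fence polynomials\<close>

text \<open>
  A word stands for a product of the matrices with rows $(z, 0), (1, 1)$ (for True) and
  $(1, 1), (0, z^{-1})$ (for False). The function below gives the coefficient of $z^i$ in an entry of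
  the product, with True naming the first row or column and False the second.
\<close>
fun entry :: "bool list \<Rightarrow> bool \<Rightarrow> bool \<Rightarrow> int \<Rightarrow> int" where
  "entry [] r c i = (if r = c \<and> i = 0 then 1 else 0)"
| "entry (True # w) True c i = entry w True c (i - 1)"
| "entry (True # w) False c i = entry w True c i + entry w False c i"
| "entry (False # w) True c i = entry w True c i + entry w False c i"
| "entry (False # w) False c i = entry w False c (i + 1)"

text \<open>The two letters have determinants z and 1/z, so this is the exponent k with det M = z^k;
  it fixes all centres of symmetry below.\<close>

fun word_degree :: "bool list \<Rightarrow> int" where
  "word_degree [] = 0"
| "word_degree (x # w) = (if x then 1 else - 1) + word_degree w"

lemma word_degree_append [simp]: "word_degree (u @ w) = word_degree u + word_degree w"
  by (induction u) auto

text \<open>\<open>entry\<close> unfolds from the left, while the sign induction removes letters at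
  both ends. These rules are multiplication by a letter from the right.\<close>

lemma entry_snoc [simp]:
  "entry (w @ [True]) r True i = entry w r True (i - 1) + entry w r False i"
  "entry (w @ [True]) r False i = entry w r False i"
  "entry (w @ [False]) r True i = entry w r True i"
  "entry (w @ [False]) r False i = entry w r True i + entry w r False (i + 1)"
proof (induction w arbitrary: r i)
  case Nil
  { case 1 then show ?case by (cases r) auto }
  { case 2 then show ?case by (cases r) auto }
  { case 3 then show ?case by (cases r) auto }
  { case 4 then show ?case by (cases r) auto }
next
  case (Cons x w)
  { case 1 then show ?case by (cases r; cases x) (auto simp: Cons.IH algebra_simps) }
  { case 2 then show ?case by (cases r; cases x) (auto simp: Cons.IH algebra_simps) }
  { case 3 then show ?case by (cases r; cases x) (auto simp: Cons.IH algebra_simps) }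
  { case 4 then show ?case by (cases r; cases x) (auto simp: Cons.IH algebra_simps) }
qed

text \<open>
  With $k$ the degree of the word, $M$ its matrix, $\tilde M$ the matrix with $z$ replaced by $1/z$
  and $H$ the matrix with rows $(z, z - 1)$ and $(1 - z, 1)$, one has $M H = z^k H \tilde M$; these
  are the last four identities. The first two (the trace of $M$, and $b - z c$, are palindromic)
  follow from it only after dividing by $\det H$, and are carried along in the induction instead.
\<close>
lemma entry_reversal:
  defines "A \<equiv> \<lambda>w. entry w True True" and "B \<equiv> \<lambda>w. entry w True False"
    and "C \<equiv> \<lambda>w. entry w False True" and "D \<equiv> \<lambda>w. entry w False False"
  shows "A w i - A w (word_degree w - i) + D w i - D w (word_degree w - i) = 0"
    and "B w i - B w (word_degree w + 1 - i) = C w (i - 1) - C w (word_degree w - i)"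
    and "A w (i - 1) + B w i - B w (i - 1) = A w (word_degree w + 1 - i) - C w (word_degree w - i) + C w (word_degree w + 1 - i)"
    and "B w i - B w (word_degree w + 1 - i) = A w i - A w (i - 1) - D w (word_degree w - i) + D w (word_degree w + 1 - i)"
    and "C w (i - 1) - C w (word_degree w - i) = A w (word_degree w - i) - A w (word_degree w + 1 - i) - D w i + D w (i - 1)"
    and "D w i - D w (word_degree w - i) = C w i - C w (i - 1) + B w (word_degree w - i) - B w (word_degree w + 1 - i)"
proof (induction w arbitrary: i)
  case Nil
  { case 1 then show ?case by (auto simp: assms) }
  { case 2 then show ?case by (auto simp: assms) }
  { case 3 then show ?case by (auto simp: assms) }
  { case 4 then show ?case by (auto simp: assms) }
  { case 5 then show ?case by (auto simp: assms) }
  { case 6 then show ?case by (auto simp: assms) }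
next
  case (Cons x w)
  have s [simp]: "A (True # w) i = A w (i - 1)" "B (True # w) i = B w (i - 1)"
    "C (True # w) i = A w i + C w i" "D (True # w) i = B w i + D w i"
    "A (False # w) i = A w i + C w i" "B (False # w) i = B w i + D w i"
    "C (False # w) i = C w (i + 1)" "D (False # w) i = D w (i + 1)" for i
    by (simp_all add: assms)
  note I = Cons.IH
  { case 1 show ?case using I(1)[of i] I(4)[of i] I(5)[of "i + 1"] by (cases x) (simp_all add: algebra_simps) }
  { case 2 show ?case using I(2)[of i] I(3)[of i] I(6)[of i] by (cases x) (simp_all add: algebra_simps) }
  { case 3 show ?case using I(3)[of i] I(3)[of "i - 1"] I(5)[of i] by (cases x) (simp_all add: algebra_simps) }
  { case 4 show ?case using I(4)[of i] I(4)[of "i - 1"] I(6)[of i] by (cases x) (simp_all add: algebra_simps) }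
  { case 5 show ?case using I(3)[of i] I(5)[of i] I(5)[of "i + 1"] by (cases x) (simp_all add: algebra_simps) }
  { case 6 show ?case using I(4)[of i] I(6)[of i] I(6)[of "i + 1"] by (cases x) (simp_all add: algebra_simps) }
qed


section \<open>Comparing coefficients about a centre of symmetry\<close>

text \<open>
  The coefficients of $P - z^c \tilde P$ below the centre of symmetry $c / 2$ are nonpositive
  in the first case and nonnegative in the second.
\<close>
definition tilts_up :: "(int \<Rightarrow> int) \<Rightarrow> int \<Rightarrow> bool" where
  "tilts_up P c \<longleftrightarrow> (\<forall>i. 2 * i \<le> c \<longrightarrow> P i \<le> P (c - i))"

definition tilts_down :: "(int \<Rightarrow> int) \<Rightarrow> int \<Rightarrow> bool" where
  "tilts_down P c \<longleftrightarrow> (\<forall>i. 2 * i \<le> c \<longrightarrow> P (c - i) \<le> P i)"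

definition unimodal :: "(int \<Rightarrow> 'a::linorder) \<Rightarrow> int \<Rightarrow> bool" where
  "unimodal P t \<longleftrightarrow> (\<forall>i j. i \<le> j \<and> j \<le> t \<longrightarrow> P i \<le> P j) \<and> (\<forall>i j. t \<le> i \<and> i \<le> j \<longrightarrow> P j \<le> P i)"

lemma unimodalI:
  fixes P :: "int \<Rightarrow> 'a::linorder"
  assumes "\<And>i. i < t \<Longrightarrow> P i \<le> P (i + 1)" and "\<And>i. t \<le> i \<Longrightarrow> P (i + 1) \<le> P i"
  shows "unimodal P t"
proof -
  have 1: "P i \<le> P j" if "i \<le> j" "j \<le> t" for i j
    using that
  proof (induction j rule: int_ge_induct)
    case (step j)
    then show ?case using assms(1)[of j] by fastforce
  qed simp
  have 2: "P j \<le> P i" if "t \<le> i" "i \<le> j" for i j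
    using that(2,1)
  proof (induction j rule: int_ge_induct)
    case (step j)
    then show ?case using assms(2)[of j] by fastforce
  qed simp
  show ?thesis unfolding unimodal_def using 1 2 by blast
qed

text \<open>Reflecting about c/2 and then about (c + 1)/2 is translation by one, so P i and P (i +
  1) are compared through P (c - i).\<close>

lemma interlacing_unimodal:
  assumes "tilts_up P c" and "tilts_down P (c + 1)"
  shows "unimodal P ((c + 1) div 2)"
proof (rule unimodalI)
  fix i :: int
  assume "i < (c + 1) div 2"
  then have "2 * i \<le> c" "2 * (i + 1) \<le> c + 1" by presburger+
  then have "P i \<le> P (c - i)" "P (c + 1 - (i + 1)) \<le> P (i + 1)"
    using assms unfolding tilts_up_def tilts_down_def by blast+
  then show "P i \<le> P (i + 1)" by simp
next
  fix i :: int
  assume "(c + 1) div 2 \<le> i"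
  then have "2 * (c - i) \<le> c" "2 * (c - i) \<le> c + 1" by presburger+
  then have "P (c + 1 - (c - i)) \<le> P (c - i)" "P (c - i) \<le> P (c - (c - i))"
    using assms unfolding tilts_up_def tilts_down_def by blast+
  then show "P (i + 1) \<le> P i" by (simp add: algebra_simps)
qed

text \<open>If m - i is not beyond the peak, monotonicity suffices. Otherwise P (m - i) dominates P
  (c - i), because c - i lies further out on the falling side. The next lemma is the mirror
  image.\<close>

lemma interlacing_tilts_up:
  assumes "tilts_up P c" and "tilts_down P (c + 1)" and "m \<le> c"
  shows "tilts_up P m"
  unfolding tilts_up_def
proof (intro allI impI)
  fix i assume i: "2 * i \<le> m"
  note u = interlacing_unimodal[OF assms(1,2), unfolded unimodal_def]
  show "P i \<le> P (m - i)"
  proof (cases "m - i \<le> (c + 1) div 2")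
    case True
    then show ?thesis using u i by auto
  next
    case False
    then have "P (c - i) \<le> P (m - i)" using u assms(3) by auto
    moreover have "P i \<le> P (c - i)" using assms i by (simp add: tilts_up_def)
    ultimately show ?thesis by simp
  qed
qed

lemma interlacing_tilts_down:
  assumes "tilts_up P c" and "tilts_down P (c + 1)" and "c + 1 \<le> m"
  shows "tilts_down P m"
  unfolding tilts_down_def
proof (intro allI impI)
  fix i assume i: "2 * i \<le> m"
  note u = interlacing_unimodal[OF assms(1,2), unfolded unimodal_def]
  show "P (m - i) \<le> P i"
  proof (cases "(c + 1) div 2 \<le> i")
    case True
    then show ?thesis using u i by auto
  next
    case False
    then have "2 * i \<le> c + 1" "(c + 1) div 2 \<le> c + 1 - i" by linarith+
    then have "P (m - i) \<le> P (c + 1 - i)" "P (c + 1 - i) \<le> P i"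
      using u assms by (auto simp: tilts_down_def)
    then show ?thesis by simp
  qed
qed

section \<open>Signs of fence polynomials\<close>

text \<open>
  This is $(1, 1) \, M \, (z, 1)^T$. It is, up to a shift, the numerator of a $q$-deformed rational and the
  rank polynomial of a fence poset; each corner entry of a longer word equals such a polynomial.
\<close>
definition fence :: "bool list \<Rightarrow> int \<Rightarrow> int" where
  "fence w i = entry w True True (i - 1) + entry w True False i + entry w False True (i - 1) + entry w False False i"

text \<open>With k the degree, both alternatives imply tilting up at k and down at k + 2. They
  differ in the sign at k + 1, which locates the centre of the interlacing.\<close>

definition interlaced_fence :: "bool list \<Rightarrow> bool" where
  "interlaced_fence w \<longleftrightarrow> tilts_up (fence w) (word_degree w) \<and> tilts_down (fence w) (word_degree w + 1) \<or>
     tilts_up (fence w) (word_degree w + 1) \<and> tilts_down (fence w) (word_degree w + 2)"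

text \<open>All centres m on one side are included because removing a letter can shift the centre of
  an entry by 2 while the degree changes only by 1.\<close>

definition entry_signs :: "bool list \<Rightarrow> bool" where
  "entry_signs w \<longleftrightarrow> (\<forall>m\<le>word_degree w. tilts_up (entry w True True) m) \<and> (\<forall>m\<ge>word_degree w. tilts_down (entry w False False) m) \<and>
     (tilts_up (entry w True False) (word_degree w + 1) \<or> tilts_down (entry w True False) (word_degree w + 1))"

lemma interlaced_fence_tilts_up:
  assumes "interlaced_fence w" and "m \<le> word_degree w"
  shows "tilts_up (fence w) m"
  using assms(1) unfolding interlaced_fence_def
proof
  assume "tilts_up (fence w) (word_degree w) \<and> tilts_down (fence w) (word_degree w + 1)"
  then show ?thesis using interlacing_tilts_up assms(2) by blast
next
  assume "tilts_up (fence w) (word_degree w + 1) \<and> tilts_down (fence w) (word_degree w + 2)"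
  then show ?thesis using interlacing_tilts_up[of "fence w" "word_degree w + 1" m] assms(2) by (simp add: add.assoc)
qed

lemma interlaced_fence_tilts_down:
  assumes "interlaced_fence w" and "word_degree w + 2 \<le> m"
  shows "tilts_down (fence w) m"
  using assms(1) unfolding interlaced_fence_def
proof
  assume "tilts_up (fence w) (word_degree w) \<and> tilts_down (fence w) (word_degree w + 1)"
  then show ?thesis using interlacing_tilts_down[of "fence w" "word_degree w" m] assms(2) by simp
next
  assume "tilts_up (fence w) (word_degree w + 1) \<and> tilts_down (fence w) (word_degree w + 2)"
  then show ?thesis using interlacing_tilts_down[of "fence w" "word_degree w + 1" m] assms(2) by (simp add: add.assoc)
qed

lemma tilts_up_shift: "tilts_up P (m - 2) \<Longrightarrow> tilts_up (\<lambda>i. P (i - 1)) m"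
  unfolding tilts_up_def
proof (intro allI impI)
  fix i assume "\<forall>i. 2 * i \<le> m - 2 \<longrightarrow> P i \<le> P (m - 2 - i)" "2 * i \<le> m"
  from this(1)[rule_format, of "i - 1"] this(2) show "P (i - 1) \<le> P (m - i - 1)"
    by (simp add: algebra_simps)
qed

lemma tilts_down_shift: "tilts_down P (m - 2) \<Longrightarrow> tilts_down (\<lambda>i. P (i - 1)) m"
  unfolding tilts_down_def
proof (intro allI impI)
  fix i assume "\<forall>i. 2 * i \<le> m - 2 \<longrightarrow> P (m - 2 - i) \<le> P i" "2 * i \<le> m"
  from this(1)[rule_format, of "i - 1"] this(2) show "P (m - i - 1) \<le> P (i - 1)"
    by (simp add: algebra_simps)
qed

lemma tilts_up_shift': "tilts_up P (m + 2) \<Longrightarrow> tilts_up (\<lambda>i. P (i + 1)) m"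
  unfolding tilts_up_def
proof (intro allI impI)
  fix i assume "\<forall>i. 2 * i \<le> m + 2 \<longrightarrow> P i \<le> P (m + 2 - i)" "2 * i \<le> m"
  from this(1)[rule_format, of "i + 1"] this(2) show "P (i + 1) \<le> P (m - i + 1)"
    by (simp add: algebra_simps)
qed

lemma tilts_down_shift': "tilts_down P (m + 2) \<Longrightarrow> tilts_down (\<lambda>i. P (i + 1)) m"
  unfolding tilts_down_def
proof (intro allI impI)
  fix i assume "\<forall>i. 2 * i \<le> m + 2 \<longrightarrow> P (m + 2 - i) \<le> P i" "2 * i \<le> m"
  from this(1)[rule_format, of "i + 1"] this(2) show "P (m - i + 1) \<le> P (i + 1)"
    by (simp add: algebra_simps)
qed

text \<open>Both letters have (1, 1) as a row, and their columns (z, 1) and (1, 1/z) are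
  proportional; so an entry picked out by this row and such a column is (1, 1) M (z, 1)^T up to a
  shift.\<close>

lemma fence_entries:
  "entry (False # w @ [True]) True True i = fence w i"
  "entry (True # w @ [False]) False False i = fence w (i + 1)"
  "entry (False # w @ [False]) True False i = fence w (i + 1)"
  "entry (True # w @ [True]) False True i = fence w i"
  by (simp_all flip: append_Cons add: fence_def)

text \<open>The trace of \<open>False # w @ [True]\<close> is palindromic, and its diagonal consists
  of the fence polynomial and a shifted entry of \<open>w\<close>. The next two identities arise
  likewise from the trace of \<open>True # w @ [False]\<close> and from b - z c for
  \<open>True # w @ [True]\<close>.\<close>

lemma fence_antisym_top:
  "fence w i - fence w (word_degree w - i) = entry w False False (word_degree w + 1 - i) - entry w False False (i + 1)"
  using entry_reversal(1)[of "False # w @ [True]" i]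
  by (simp flip: append_Cons add: fence_def algebra_simps)

lemma fence_antisym_bot:
  "fence w i - fence w (word_degree w + 2 - i) = entry w True True (word_degree w - i) - entry w True True (i - 2)"
  using entry_reversal(1)[of "True # w @ [False]" "i - 1"]
  by (simp flip: append_Cons add: fence_def algebra_simps)

lemma fence_antisym_mid:
  "fence w i - fence w (word_degree w + 1 - i) = entry w True False i - entry w True False (word_degree w + 1 - i)"
  using entry_reversal(2)[of "True # w @ [True]" "i + 1"]
  by (simp flip: append_Cons add: fence_def algebra_simps)

text \<open>This is the palindromic trace of \<open>True # w\<close>, arranged to give the sign of
  the entry b of a word whose end letters differ.\<close>

lemma entry_antisym_diag:
  "entry w True False i + entry w False False i - entry w True False (word_degree w + 1 - i) - entry w False False (word_degree w + 1 - i)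
     = entry w True True (word_degree w - i) - entry w True True (i - 1)"
  using entry_reversal(1)[of "True # w" i] by (simp add: algebra_simps)


lemma word_cases:
  obtains "w = []" | x where "w = [x]" | x v y where "w = x # v @ [y]"
  by (metis append_butlast_last_id list.exhaust)

text \<open>The diagonal entries of a word are, up to shifts, entries of a word with one letter less
  or the fence polynomial of the word without both end letters. Hence induction on the length, with
  entries and fence polynomials treated together.\<close>

lemma entry_signs_fence:
  "entry_signs w \<and> interlaced_fence w"
proof (induction "length w" arbitrary: w rule: less_induct)
  case less
  have a: "tilts_up (entry w True True) m" if m: "m \<le> word_degree w" for m
  proof (cases w rule: word_cases)
    case 1
    then show ?thesis using m by (auto simp: tilts_up_def)
  next
    case (2 x)
    then show ?thesis using m by (cases x) (auto simp: tilts_up_def)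
  next
    case (3 x v y)
    note IH = less[of "v @ [y]"] less[of "x # v"] less[of v]
    show ?thesis
    proof (cases x)
      case True
      then have "tilts_up (entry (v @ [y]) True True) (m - 2)" using IH m 3 by (auto simp: entry_signs_def)
      moreover have "entry w True True = (\<lambda>i. entry (v @ [y]) True True (i - 1))" using 3 True by auto
      ultimately show ?thesis using tilts_up_shift by simp
    next
      case x: False
      show ?thesis
      proof (cases y)
        case True
        then have "entry w True True = fence v" using 3 x by (auto simp only: fence_entries)
        then show ?thesis using IH m 3 x True interlaced_fence_tilts_up[of v m] by simp
      next
        case False
        then have "entry w True True = entry (x # v) True True" using 3 by (auto simp flip: append_Cons)
        then show ?thesis using IH m 3 False by (auto simp: entry_signs_def)
      qed
    qed
  qed
  have d: "tilts_down (entry w False False) m" if m: "word_degree w \<le> m" for m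
  proof (cases w rule: word_cases)
    case 1
    then show ?thesis using m by (auto simp: tilts_down_def)
  next
    case (2 x)
    then show ?thesis using m by (cases x) (auto simp: tilts_down_def)
  next
    case (3 x v y)
    note IH = less[of "v @ [y]"] less[of "x # v"] less[of v]
    show ?thesis
    proof (cases x)
      case False
      then have "tilts_down (entry (v @ [y]) False False) (m + 2)" using IH m 3 by (auto simp: entry_signs_def)
      moreover have "entry w False False = (\<lambda>i. entry (v @ [y]) False False (i + 1))" using 3 False by auto
      ultimately show ?thesis using tilts_down_shift' by simp
    next
      case x: True
      show ?thesis
      proof (cases y)
        case False
        then have e: "entry w False False = (\<lambda>i. fence v (i + 1))" using 3 x by (auto simp only: fence_entries)
        show ?thesis unfolding e
          by (rule tilts_down_shift', rule interlaced_fence_tilts_down) (use IH m 3 x False in auto)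
      next
        case True
        then have "entry w False False = entry (x # v) False False" using 3 by (auto simp flip: append_Cons)
        then show ?thesis using IH m 3 True by (auto simp: entry_signs_def)
      qed
    qed
  qed
  have b: "tilts_up (entry w True False) (word_degree w + 1) \<or> tilts_down (entry w True False) (word_degree w + 1)"
  proof (cases w rule: word_cases)
    case 1
    then show ?thesis by (auto simp: tilts_up_def)
  next
    case (2 x)
    then show ?thesis by (cases x) (auto simp: tilts_up_def)
  next
    case (3 x v y)
    then have IH: "entry_signs v" "interlaced_fence v" using less[of v] by auto
    consider "x" "y" | "\<not> x" "\<not> y" | "\<not> x" "y" | "x" "\<not> y" by blast
    then show ?thesis
    proof cases
      case 1
      then have "entry w True False = (\<lambda>i. entry v True False (i - 1))" "word_degree w = word_degree v + 2"
        using 3 by auto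
      then have "word_degree w + 1 - 2 = word_degree v + 1" "entry w True False = (\<lambda>i. entry v True False (i - 1))" by auto
      then show ?thesis using IH(1) tilts_up_shift[of "entry v True False" "word_degree w + 1"] tilts_down_shift[of "entry v True False" "word_degree w + 1"]
        unfolding entry_signs_def by metis
    next
      case 2
      have "tilts_up (fence v) (word_degree v + 1) \<or> tilts_down (fence v) (word_degree v + 1)"
        using IH(2) by (auto simp: interlaced_fence_def)
      moreover have "entry w True False = (\<lambda>i. fence v (i + 1))"
        using 3 2 by (auto simp only: fence_entries)
      moreover have "word_degree w = word_degree v - 2" using 3 2 by simp
      then have "word_degree w + 1 + 2 = word_degree v + 1" by simp
      ultimately show ?thesis using tilts_up_shift'[of "fence v" "word_degree w + 1"] tilts_down_shift'[of "fence v" "word_degree w + 1"]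
        by metis
    next
      \<comment> \<open>For different end letters the entry b of \<open>w\<close> is b + d or z a +
        b of \<open>v\<close>. By \<open>entry_antisym_diag\<close> its antisymmetric part is, up to
        sign, that of z a or of d, whose sign is known.\<close>
      case c: 3
      have "tilts_up (entry v True True) (word_degree v - 1)" using IH by (simp add: entry_signs_def)
      then have *: "entry v True True (i - 1) \<le> entry v True True (word_degree v - i)" if "2 * i \<le> word_degree v + 1" for i
        using that unfolding tilts_up_def by (elim allE[of _ "i - 1"]) (auto simp: algebra_simps)
      then have "tilts_down (entry w True False) (word_degree w + 1)"
        unfolding tilts_down_def
      proof (intro allI impI)
        fix i assume "2 * i \<le> word_degree w + 1"
        then show "entry w True False (word_degree w + 1 - i) \<le> entry w True False i"
          using *[of i] 3 c entry_antisym_diag[of v i] by (simp add: algebra_simps)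
      qed
      then show ?thesis ..
    next
      case c: 4
      have "tilts_down (entry v False False) (word_degree v + 1)" using IH by (simp add: entry_signs_def)
      then have *: "entry v False False (word_degree v + 1 - i) \<le> entry v False False i" if "2 * i \<le> word_degree v + 1" for i
        using that unfolding tilts_down_def by auto
      then have "tilts_up (entry w True False) (word_degree w + 1)"
        unfolding tilts_up_def
      proof (intro allI impI)
        fix i assume "2 * i \<le> word_degree w + 1"
        then show "entry w True False i \<le> entry w True False (word_degree w + 1 - i)"
          using *[of i] 3 c entry_antisym_diag[of v i] by (simp add: algebra_simps)
      qed
      then show ?thesis ..
    qed
  qed
  have es: "entry_signs w" unfolding entry_signs_def using a b d by blast
  \<comment> \<open>The fence signs of \<open>w\<close> come from its own entries, not from shorter
    words: d is used at the centre k + 2, a at k - 2 and b at k + 1.\<close>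
  have "tilts_up (fence w) (word_degree w)"
    unfolding tilts_up_def
  proof (intro allI impI)
    fix i assume i: "2 * i \<le> word_degree w"
    have "tilts_down (entry w False False) (word_degree w + 2)" using d by simp
    then show "fence w i \<le> fence w (word_degree w - i)"
      using i fence_antisym_top[of w i] unfolding tilts_down_def
      by (elim allE[of _ "i + 1"]) (auto simp: algebra_simps)
  qed
  moreover have "tilts_down (fence w) (word_degree w + 2)"
    unfolding tilts_down_def
  proof (intro allI impI)
    fix i assume i: "2 * i \<le> word_degree w + 2"
    have "tilts_up (entry w True True) (word_degree w - 2)" using a by simp
    then show "fence w (word_degree w + 2 - i) \<le> fence w i"
      using i fence_antisym_bot[of w i] unfolding tilts_up_def
      by (elim allE[of _ "i - 2"]) (auto simp: algebra_simps)
  qed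
  moreover have "tilts_up (fence w) (word_degree w + 1) \<or> tilts_down (fence w) (word_degree w + 1)"
    using b
  proof
    assume b: "tilts_up (entry w True False) (word_degree w + 1)"
    have "fence w i \<le> fence w (word_degree w + 1 - i)" if "2 * i \<le> word_degree w + 1" for i
      using b that fence_antisym_mid[of w i] unfolding tilts_up_def by (elim allE[of _ i]) auto
    then show ?thesis by (simp add: tilts_up_def)
  next
    assume b: "tilts_down (entry w True False) (word_degree w + 1)"
    have "fence w (word_degree w + 1 - i) \<le> fence w i" if "2 * i \<le> word_degree w + 1" for i
      using b that fence_antisym_mid[of w i] unfolding tilts_down_def by (elim allE[of _ i]) auto
    then show ?thesis by (simp add: tilts_down_def)
  qed
  ultimately show ?case using es unfolding interlaced_fence_def by blast
qed

theorem fence_unimodal: "\<exists>t. unimodal (fence w) t"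
  using entry_signs_fence[of w] interlacing_unimodal
  unfolding interlaced_fence_def by (metis add.assoc one_add_one)

section \<open>Good gradings from unimodal multiplicities\<close>

lemma bracket_carrier [simp]:
  "x \<in> carrier_mat n n \<Longrightarrow> y \<in> carrier_mat n n \<Longrightarrow> bracket x y \<in> carrier_mat n n"
  unfolding bracket_def by (intro minus_carrier_mat mult_carrier_mat)

lemma bracket_index:
  assumes "x \<in> carrier_mat n n" and "y \<in> carrier_mat n n" and "p < n" and "q < n"
  shows "bracket x y $$ (p, q) = (\<Sum>k<n. x $$ (p, k) * y $$ (k, q)) - (\<Sum>k<n. y $$ (p, k) * x $$ (k, q))"
  using assms by (simp add: bracket_def scalar_prod_def atLeast0LessThan)

definition diag_grading :: "nat \<Rightarrow> (nat \<Rightarrow> int) \<Rightarrow> int \<Rightarrow> complex mat set" where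
  "diag_grading n v k = {x \<in> carrier_mat n n. \<forall>p<n. \<forall>q<n. x $$ (p, q) \<noteq> 0 \<longrightarrow> v p - v q = k}"

lemma diag_gradingD:
  "x \<in> diag_grading n v k \<Longrightarrow> x \<in> carrier_mat n n"
  "x \<in> diag_grading n v k \<Longrightarrow> p < n \<Longrightarrow> q < n \<Longrightarrow> v p - v q \<noteq> k \<Longrightarrow> x $$ (p, q) = 0"
  by (auto simp: diag_grading_def)

text \<open>The commutator scales the entry (p, q) by the difference of two eigenvalues, so a common
  offset \<kappa> cancels; a traceless matrix need not have integral eigenvalues.\<close>

lemma ad_eigenspace_diag:
  assumes h: "h \<in> carrier_mat n n"
    and diag: "\<And>p q. p < n \<Longrightarrow> q < n \<Longrightarrow> h $$ (p, q) = (if p = q then \<kappa> + of_int (v p) else 0)"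
  shows "ad_eigenspace n h k = diag_grading n v k"
proof -
  have "bracket h x = of_int k \<cdot>\<^sub>m x \<longleftrightarrow> (\<forall>p<n. \<forall>q<n. x $$ (p, q) \<noteq> 0 \<longrightarrow> v p - v q = k)"
    if x: "x \<in> carrier_mat n n" for x
  proof -
    have *: "bracket h x $$ (p, q) = of_int (v p - v q) * x $$ (p, q)" if "p < n" "q < n" for p q
    proof -
      have "(\<Sum>k<n. h $$ (p, k) * x $$ (k, q)) = (\<Sum>k<n. if p = k then (\<kappa> + of_int (v p)) * x $$ (k, q) else 0)"
        using that by (intro sum.cong) (auto simp: diag)
      moreover have "(\<Sum>k<n. x $$ (p, k) * h $$ (k, q)) = (\<Sum>k<n. if q = k then x $$ (p, k) * (\<kappa> + of_int (v q)) else 0)"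
        using that by (intro sum.cong) (auto simp: diag)
      ultimately show ?thesis
        using that bracket_index[OF h x that] by (simp add: sum.delta' algebra_simps)
    qed
    have "bracket h x = of_int k \<cdot>\<^sub>m x \<longleftrightarrow> (\<forall>p<n. \<forall>q<n. bracket h x $$ (p, q) = of_int k * x $$ (p, q))"
      using carrier_matD[OF x] carrier_matD[OF bracket_carrier[OF h x]] by (auto simp: mat_eq_iff)
    also have "\<dots> \<longleftrightarrow> (\<forall>p<n. \<forall>q<n. (of_int (v p - v q) :: complex) * x $$ (p, q) = of_int k * x $$ (p, q))"
      using * by auto
    also have "\<dots> \<longleftrightarrow> (\<forall>p<n. \<forall>q<n. x $$ (p, q) \<noteq> 0 \<longrightarrow> v p - v q = k)"
      unfolding mult_cancel_right of_int_eq_iff by blast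
    finally show ?thesis .
  qed
  then show ?thesis by (auto simp: ad_eigenspace_def diag_grading_def)
qed

lemma bracket_diag_grading:
  assumes "x \<in> diag_grading n v i" and "y \<in> diag_grading n v j"
  shows "bracket x y \<in> diag_grading n v (i + j)"
proof -
  have c: "x \<in> carrier_mat n n" "y \<in> carrier_mat n n" using assms by (auto simp: diag_grading_def)
  have "bracket x y $$ (p, q) = 0" if pq: "p < n" "q < n" "v p - v q \<noteq> i + j" for p q
  proof -
    have "x $$ (p, k) * y $$ (k, q) = 0" "y $$ (p, k) * x $$ (k, q) = 0" if "k < n" for k
    proof -
      have "x $$ (p, k) = 0 \<or> y $$ (k, q) = 0" "y $$ (p, k) = 0 \<or> x $$ (k, q) = 0"
        using assms pq that unfolding diag_grading_def by (smt (verit) mem_Collect_eq)+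
      then show "x $$ (p, k) * y $$ (k, q) = 0" "y $$ (p, k) * x $$ (k, q) = 0" by auto
    qed
    then show ?thesis unfolding bracket_index[OF c pq(1,2)] by (metis (no_types, lifting) diff_self lessThan_iff sum.neutral)
  qed
  then show ?thesis using c by (auto simp: diag_grading_def)
qed

lemma gl_grading_diag: "gl_grading n (diag_grading n v)"
  unfolding gl_grading_def
proof (intro conjI allI ballI)
  fix j
  show "mat_subspace n (diag_grading n v j)"
    unfolding mat_subspace_def diag_grading_def by auto (metis add.right_neutral)
next
  fix i j x y
  assume "x \<in> diag_grading n v i" "y \<in> diag_grading n v j"
  then show "bracket x y \<in> diag_grading n v (i + j)" by (rule bracket_diag_grading)
next
  fix x :: "complex mat" assume x: "x \<in> carrier_mat n n"
  define P where "P = (\<lambda>f. (\<forall>j. f j \<in> diag_grading n v j) \<and> finite {j. f j \<noteq> 0\<^sub>m n n} \<and>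
        x = mat n n (\<lambda>(p, q). \<Sum>j | f j \<noteq> 0\<^sub>m n n. f j $$ (p, q)))"
  define f0 where "f0 = (\<lambda>j. mat n n (\<lambda>(p, q). if v p - v q = j then x $$ (p, q) else 0))"
  \<comment> \<open>The entry (p, q) can be nonzero only in the component of degree
    \<open>v p - v q\<close>, which must therefore carry all of it.\<close>
  have determined: "f j $$ (p, q) = f0 j $$ (p, q)"
    if f: "P f" and pq: "p < n" "q < n" for f j p q
  proof -
    have fj: "f i \<in> diag_grading n v i" for i using f by (simp add: P_def)
    have zero: "f i $$ (p, q) = 0" if "i \<noteq> v p - v q" for i
      using fj[of i] pq that by (auto simp: diag_grading_def)
    have "x $$ (p, q) = (\<Sum>j | f j \<noteq> 0\<^sub>m n n. f j $$ (p, q))"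
      using f pq unfolding P_def by (metis (mono_tags, lifting) index_mat(1) case_prod_conv)
    also have "\<dots> = (\<Sum>j | f j \<noteq> 0\<^sub>m n n. if j = v p - v q then f j $$ (p, q) else 0)"
      by (intro sum.cong) (auto simp: zero)
    also have "\<dots> = f (v p - v q) $$ (p, q)"
      using f pq by (auto simp: P_def sum.delta)
    finally show ?thesis using zero[of j] pq by (auto simp: f0_def)
  qed
  have supp: "{j. f0 j \<noteq> 0\<^sub>m n n} \<subseteq> (\<lambda>(p, q). v p - v q) ` ({..<n} \<times> {..<n})"
  proof
    fix j assume "j \<in> {j. f0 j \<noteq> 0\<^sub>m n n}"
    then obtain p q where "p < n" "q < n" "f0 j $$ (p, q) \<noteq> 0"
      by (auto simp: mat_eq_iff f0_def)
    then have "v p - v q = j" by (auto simp: f0_def split: if_splits)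
    then show "j \<in> (\<lambda>(p, q). v p - v q) ` ({..<n} \<times> {..<n})"
      using \<open>p < n\<close> \<open>q < n\<close> by force
  qed
  then have fin: "finite {j. f0 j \<noteq> 0\<^sub>m n n}" by (rule finite_subset) simp
  have "P f0"
    unfolding P_def
  proof (intro conjI allI fin)
    show "f0 j \<in> diag_grading n v j" for j by (auto simp: f0_def diag_grading_def)
    show "x = mat n n (\<lambda>(p, q). \<Sum>j | f0 j \<noteq> 0\<^sub>m n n. f0 j $$ (p, q))"
    proof (rule eq_matI)
      fix p q assume "p < dim_row (mat n n (\<lambda>(p, q). \<Sum>j | f0 j \<noteq> 0\<^sub>m n n. f0 j $$ (p, q)))"
        "q < dim_col (mat n n (\<lambda>(p, q). \<Sum>j | f0 j \<noteq> 0\<^sub>m n n. f0 j $$ (p, q)))"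
      then have pq: "p < n" "q < n" by auto
      have "(\<Sum>j | f0 j \<noteq> 0\<^sub>m n n. f0 j $$ (p, q)) = (\<Sum>j | f0 j \<noteq> 0\<^sub>m n n. if j = v p - v q then x $$ (p, q) else 0)"
        using pq by (intro sum.cong) (auto simp: f0_def)
      also have "\<dots> = x $$ (p, q)"
      proof (cases "f0 (v p - v q) = 0\<^sub>m n n")
        \<comment> \<open>A vanishing component is missing from the index set of the sum; the entry
          of \<open>x\<close> is then zero as well.\<close>
        case True
        then have "f0 (v p - v q) $$ (p, q) = 0" using pq by simp
        then have "x $$ (p, q) = 0" using pq by (simp add: f0_def)
        then show ?thesis by (simp cong: if_cong)
      qed (use fin in \<open>simp add: sum.delta\<close>)
      finally show "x $$ (p, q) = mat n n (\<lambda>(p, q). \<Sum>j | f0 j \<noteq> 0\<^sub>m n n. f0 j $$ (p, q)) $$ (p, q)"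
        using pq by simp
    qed (use x in auto)
  qed
  moreover have "f = f0" if "P f" for f
  proof
    fix j
    have "f j \<in> carrier_mat n n" using that by (auto simp: P_def diag_grading_def)
    then show "f j = f0 j"
      using determined[OF that, of _ _ j] by (intro eq_matI) (auto simp: f0_def)
  qed
  ultimately have "\<exists>!f. P f" by blast
  then show "\<exists>!f. (\<forall>j. f j \<in> diag_grading n v j) \<and> finite {j. f j \<noteq> 0\<^sub>m n n} \<and>
        x = mat n n (\<lambda>(p, q). \<Sum>j | f j \<noteq> 0\<^sub>m n n. f j $$ (p, q))"
    by (simp add: P_def)
qed

section \<open>Difference equations on nested intervals\<close>

text \<open>A nonzero value would spread forever, against finiteness of \<open>A\<close>. As
  \<open>j\<close> is negative, convexity and nesting make the equation available at each step, to
  the right if \<open>A\<close> lies in \<open>B\<close> and to the left if \<open>B\<close> lies in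
  \<open>A\<close>.\<close>

lemma shift_kernel:
  fixes f :: "int \<Rightarrow> complex" and A B :: "int set"
  assumes supp: "\<And>s. f s \<noteq> 0 \<Longrightarrow> s \<in> A \<and> s + j \<in> B"
    and eq: "\<And>s. s \<in> A \<Longrightarrow> s + j + 1 \<in> B \<Longrightarrow> f s = f (s + 1)"
    and conv: "\<And>x y z. x \<in> A \<Longrightarrow> z \<in> A \<Longrightarrow> x \<le> y \<Longrightarrow> y \<le> z \<Longrightarrow> y \<in> A"
      "\<And>x y z. x \<in> B \<Longrightarrow> z \<in> B \<Longrightarrow> x \<le> y \<Longrightarrow> y \<le> z \<Longrightarrow> y \<in> B"
    and fin: "finite A" and nest: "A \<subseteq> B \<or> B \<subseteq> A" and j: "j \<le> - 1"
  shows "f s = 0"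
proof (rule ccontr)
  assume s: "f s \<noteq> 0"
  from nest show False
  proof
    assume AB: "A \<subseteq> B"
    have "f (s + int k) = f s" for k
    proof (induction k)
      case (Suc k)
      then have "s + k \<in> A" using supp s by metis
      moreover have "s + k + j + 1 \<in> B"
        using conv(2)[of "s + j" "s + k" "s + k + j + 1"] supp[OF s] calculation AB j by auto
      ultimately show ?case using eq[of "s + k"] Suc by (simp add: algebra_simps)
    qed simp
    then have "range (\<lambda>k. s + int k) \<subseteq> A" using supp s by (metis image_subsetI)
    then have "finite (range (\<lambda>k. s + int k))" using fin finite_subset by blast
    then show False using finite_imageD[of "\<lambda>k. s + int k" UNIV] by (auto simp: inj_on_def)
  next
    assume BA: "B \<subseteq> A"
    have "f (s - int k) = f s" for k
    proof (induction k)
      case (Suc k)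
      then have *: "s - k \<in> A" "s - k + j \<in> B" using supp s by metis+
      moreover have "s - k - 1 \<in> A"
        using conv(1)[of "s - k + j" "s - k" "s - k - 1"] * BA j by auto
      ultimately show ?case using eq[of "s - k - 1"] Suc by (simp add: algebra_simps)
    qed simp
    then have "range (\<lambda>k. s - int k) \<subseteq> A" using supp s by (metis image_subsetI)
    then have "finite (range (\<lambda>k. s - int k))" using fin finite_subset by blast
    then show False using finite_imageD[of "\<lambda>k. s - int k" UNIV] by (auto simp: inj_on_def)
  qed
qed

text \<open>A telescoping sum from the right or from the left end solves the equation; the nesting
  decides which. Convexity places one of s and s + 1 in the support, and if the other is outside,
  its default value 0 agrees with an empty sum.\<close>

lemma shift_surjective:
  fixes g :: "int \<Rightarrow> complex" and A B :: "int set"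
  assumes conv: "\<And>x y z. x \<in> A \<Longrightarrow> z \<in> A \<Longrightarrow> x \<le> y \<Longrightarrow> y \<le> z \<Longrightarrow> y \<in> A"
      "\<And>x y z. x \<in> B \<Longrightarrow> z \<in> B \<Longrightarrow> x \<le> y \<Longrightarrow> y \<le> z \<Longrightarrow> y \<in> B"
    and fin: "finite A" and nest: "A \<subseteq> B \<or> B \<subseteq> A" and j: "0 \<le> j"
  shows "\<exists>f. (\<forall>s. f s \<noteq> 0 \<longrightarrow> s \<in> A \<and> s + j \<in> B) \<and>
    (\<forall>s. s \<in> A \<longrightarrow> s + j + 1 \<in> B \<longrightarrow> f s - f (s + 1) = g s)"
proof -
  define A' where "A' = {s \<in> A. s + j + 1 \<in> B}"
  have fin': "finite A'" using fin by (simp add: A'_def)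
  from nest show ?thesis
  proof
    assume AB: "A \<subseteq> B"
    define f where "f = (\<lambda>s. if s \<in> A \<and> s + j \<in> B then \<Sum>w\<in>{w \<in> A'. s \<le> w}. g w else 0)"
    have "f s - f (s + 1) = g s" if s: "s \<in> A" "s + j + 1 \<in> B" for s
    proof -
      have split: "{w \<in> A'. s \<le> w} = insert s {w \<in> A'. s + 1 \<le> w}" using s by (auto simp: A'_def)
      have "s + j \<in> B" using conv(2)[of s "s + j + 1" "s + j"] s AB j by auto
      then have "f s = g s + (\<Sum>w\<in>{w \<in> A'. s + 1 \<le> w}. g w)"
        using s fin' unfolding f_def split by simp
      moreover have "f (s + 1) = (\<Sum>w\<in>{w \<in> A'. s + 1 \<le> w}. g w)"
      proof (cases "s + 1 \<in> A")
        case True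
        then show ?thesis using s by (simp add: f_def algebra_simps)
      next
        case False
        then have e: "{w \<in> A'. s + 1 \<le> w} = {}" using conv(1)[of s _ "s + 1"] s by (auto simp: A'_def)
        show ?thesis unfolding f_def e using False by simp
      qed
      ultimately show ?thesis by simp
    qed
    moreover have "f s \<noteq> 0 \<longrightarrow> s \<in> A \<and> s + j \<in> B" for s by (simp add: f_def)
    ultimately show ?thesis by blast
  next
    assume BA: "B \<subseteq> A"
    define f where "f = (\<lambda>s. if s \<in> A \<and> s + j \<in> B then - (\<Sum>w\<in>{w \<in> A'. w < s}. g w) else 0)"
    have "f s - f (s + 1) = g s" if s: "s \<in> A" "s + j + 1 \<in> B" for s
    proof -
      have split: "{w \<in> A'. w < s + 1} = insert s {w \<in> A'. w < s}" using s by (auto simp: A'_def)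
      have "s + 1 \<in> A" using conv(1)[of s "s + j + 1" "s + 1"] s BA j by auto
      then have "f (s + 1) = - (g s + (\<Sum>w\<in>{w \<in> A'. w < s}. g w))"
        using s fin' unfolding f_def split by (simp add: algebra_simps)
      moreover have "f s = - (\<Sum>w\<in>{w \<in> A'. w < s}. g w)"
      proof (cases "s + j \<in> B")
        case True
        then show ?thesis using s by (simp add: f_def)
      next
        case False
        then have e: "{w \<in> A'. w < s} = {}" using conv(2)[of _ "s + j + 1" "s + j"] s by (fastforce simp: A'_def)
        show ?thesis unfolding f_def e using False by simp
      qed
      ultimately show ?thesis by simp
    qed
    moreover have "f s \<noteq> 0 \<longrightarrow> s \<in> A \<and> s + j \<in> B" for s by (simp add: f_def)
    ultimately show ?thesis by blast
  qed
qed

section \<open>Pyramids\<close>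

text \<open>
  The boxes of a pyramid: index \<open>i\<close> sits in column \<open>v i\<close> and in the row \<open>row i\<close>. Unimodality of the
  column heights makes every row an interval, and the rows are nested.
\<close>
locale pyramid =
  fixes n :: nat and v :: "nat \<Rightarrow> int" and row :: "nat \<Rightarrow> nat" and box :: "int \<Rightarrow> nat \<Rightarrow> nat" and height :: "int \<Rightarrow> nat" and t
  assumes row: "i < n \<Longrightarrow> row i < height (v i)" and box_row: "i < n \<Longrightarrow> box (v i) (row i) = i"
    and box: "r < height s \<Longrightarrow> box s r < n" and v_box: "r < height s \<Longrightarrow> v (box s r) = s"
    and row_box: "r < height s \<Longrightarrow> row (box s r) = r"
    and height: "unimodal height t"
begin

text \<open>The nilpotent element e of the good grading: its Jordan blocks are the rows of the
  pyramid.\<close>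

definition shift_matrix :: "complex mat" where
  "shift_matrix = mat n n (\<lambda>(p, q). if v p = v q + 1 \<and> row p = row q then 1 else 0)"

text \<open>The value 0 outside the pyramid spares a case distinction for neighbours beyond the end
  of a row.\<close>

definition boxed :: "complex mat \<Rightarrow> int \<Rightarrow> nat \<Rightarrow> int \<Rightarrow> nat \<Rightarrow> complex" where
  "boxed x s r s' r' = (if r < height s \<and> r' < height s' then x $$ (box s r, box s' r') else 0)"

lemma shift_matrix_grading: "shift_matrix \<in> diag_grading n v 1"
  by (auto simp: shift_matrix_def diag_grading_def split: if_splits)

lemma index_eq_boxed: "p < n \<Longrightarrow> q < n \<Longrightarrow> x $$ (p, q) = boxed x (v p) (row p) (v q) (row q)"
  by (simp add: boxed_def row box_row)

definition strip :: "nat \<Rightarrow> int set" where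
  "strip r = {s. r < height s}"

text \<open>Superlevel sets of a unimodal function are intervals; this is where unimodality
  enters.\<close>

lemma strip_convex: "x \<in> strip r \<Longrightarrow> z \<in> strip r \<Longrightarrow> x \<le> y \<Longrightarrow> y \<le> z \<Longrightarrow> y \<in> strip r"
  using height unfolding unimodal_def strip_def mem_Collect_eq by (metis le_cases order_less_le_trans)

lemma strip_finite: "finite (strip r)"
proof (rule finite_subset)
  show "strip r \<subseteq> v ` {..<n}"
  proof
    fix s assume "s \<in> strip r"
    then have "v (box s r) = s" "box s r < n" using box v_box by (auto simp: strip_def)
    then show "s \<in> v ` {..<n}" by force
  qed
qed simp

lemma strip_nested: "strip r \<subseteq> strip r' \<or> strip r' \<subseteq> strip r"
  by (cases "r \<le> r'") (auto simp: strip_def)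

lemma bracket_shift_matrix:
  assumes x: "x \<in> carrier_mat n n" and pq: "p < n" "q < n"
  shows "bracket shift_matrix x $$ (p, q) =
    boxed x (v p - 1) (row p) (v q) (row q) - boxed x (v p) (row p) (v q + 1) (row q)"
proof -
  have k: "k = box s r \<longleftrightarrow> v k = s \<and> row k = r" if "k < n" "r < height s" for k s r
    using that row box_row box v_box row_box by metis
  have no: "\<not> (v k = s \<and> row k = r)" if "k < n" "\<not> r < height s" for k s r
    using that row by metis
  have "(\<Sum>k<n. shift_matrix $$ (p, k) * x $$ (k, q)) = boxed x (v p - 1) (row p) (v q) (row q)"
  proof (cases "row p < height (v p - 1)")
    case True
    then have "(\<Sum>k<n. shift_matrix $$ (p, k) * x $$ (k, q)) = (\<Sum>k<n. if k = box (v p - 1) (row p) then x $$ (k, q) else 0)"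
      using pq by (intro sum.cong) (auto simp: shift_matrix_def k)
    also have "\<dots> = boxed x (v p - 1) (row p) (v q) (row q)"
      using True pq box[OF True] by (simp add: boxed_def row box_row)
    finally show ?thesis .
  next
    case False
    then have "shift_matrix $$ (p, k) = 0" if "k < n" for k using no[OF that False] that pq by (auto simp: shift_matrix_def)
    then show ?thesis using False by (simp add: boxed_def)
  qed
  moreover have "(\<Sum>k<n. x $$ (p, k) * shift_matrix $$ (k, q)) = boxed x (v p) (row p) (v q + 1) (row q)"
  proof (cases "row q < height (v q + 1)")
    case True
    then have "(\<Sum>k<n. x $$ (p, k) * shift_matrix $$ (k, q)) = (\<Sum>k<n. if k = box (v q + 1) (row q) then x $$ (p, k) else 0)"
      using pq by (intro sum.cong) (auto simp: shift_matrix_def k)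
    also have "\<dots> = boxed x (v p) (row p) (v q + 1) (row q)"
      using True pq box[OF True] by (simp add: boxed_def row box_row)
    finally show ?thesis .
  next
    case False
    then have "shift_matrix $$ (k, q) = 0" if "k < n" for k using no[OF that False] that pq by (auto simp: shift_matrix_def)
    then show ?thesis using False by (simp add: boxed_def)
  qed
  ultimately show ?thesis using bracket_index[OF _ x pq, of shift_matrix] by (simp add: shift_matrix_def)
qed

text \<open>For a fixed pair of rows and a fixed degree, bracketing with e becomes the operator f s
  - f (s + 1) of the two lemmas on intervals.\<close>

lemma bracket_shift_matrix_box:
  assumes x: "x \<in> carrier_mat n n" and "r' < height (s + j + 1)" "r < height s"
  shows "bracket shift_matrix x $$ (box (s + j + 1) r', box s r) = boxed x (s + j) r' s r - boxed x (s + 1 + j) r' (s + 1) r"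
  using bracket_shift_matrix[OF x, of "box (s + j + 1) r'" "box s r"] assms by (simp add: box v_box row_box algebra_simps)

lemma bracket_shift_matrix_inj:
  assumes "j \<le> - 1"
  shows "inj_on (bracket shift_matrix) (diag_grading n v j)"
proof
  fix x y assume xy: "x \<in> diag_grading n v j" "y \<in> diag_grading n v j" "bracket shift_matrix x = bracket shift_matrix y"
  then have c: "x \<in> carrier_mat n n" "y \<in> carrier_mat n n" by (auto simp: diag_grading_def)
  have *: "boxed x (s + j) r' s r - boxed y (s + j) r' s r = 0" for s r r'
  proof (rule shift_kernel[OF _ _ strip_convex strip_convex strip_finite strip_nested assms])
    fix s assume s: "s \<in> strip r" "s + j + 1 \<in> strip r'"
    then have "boxed x (s + j) r' s r - boxed x (s + 1 + j) r' (s + 1) r = boxed y (s + j) r' s r - boxed y (s + 1 + j) r' (s + 1) r"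
      using bracket_shift_matrix_box[OF c(1)] bracket_shift_matrix_box[OF c(2)] xy(3) by (simp add: strip_def)
    then show "boxed x (s + j) r' s r - boxed y (s + j) r' s r = boxed x (s + 1 + j) r' (s + 1) r - boxed y (s + 1 + j) r' (s + 1) r"
      by (simp add: algebra_simps)
  next
    show "s \<in> strip r \<and> s + j \<in> strip r'"
      if "boxed x (s + j) r' s r - boxed y (s + j) r' s r \<noteq> 0" for s
      using that by (auto simp: boxed_def strip_def split: if_splits)
  qed
  show "x = y"
  proof (rule eq_matI)
    fix p q assume "p < dim_row y" "q < dim_col y"
    then have pq: "p < n" "q < n" using c by auto
    show "x $$ (p, q) = y $$ (p, q)"
    proof (cases "v p - v q = j")
      case True
      then have "v p = v q + j" by simp
      then show ?thesis using *[of "v q" "row p" "row q"] pq by (simp add: index_eq_boxed)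
    next
      case False
      then show ?thesis using diag_gradingD(2)[OF xy(1) pq] diag_gradingD(2)[OF xy(2) pq] by simp
    qed
  qed (use c in auto)
qed

lemma bracket_shift_matrix_surj:
  assumes j: "0 \<le> j"
  shows "bracket shift_matrix ` diag_grading n v j = diag_grading n v (j + 1)"
proof
  show "bracket shift_matrix ` diag_grading n v j \<subseteq> diag_grading n v (j + 1)"
    using bracket_diag_grading[OF shift_matrix_grading] by (force simp: add.commute)
  show "diag_grading n v (j + 1) \<subseteq> bracket shift_matrix ` diag_grading n v j"
  proof
    fix y assume y: "y \<in> diag_grading n v (j + 1)"
    \<comment> \<open>The equation for a preimage splits into independent systems, one for each pair
      of rows.\<close>
    have "\<forall>r r'. \<exists>f. (\<forall>s. f s \<noteq> 0 \<longrightarrow> r < height s \<and> r' < height (s + j)) \<and>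
       (\<forall>s. r < height s \<longrightarrow> r' < height (s + j + 1) \<longrightarrow> f s - f (s + 1) = y $$ (box (s + j + 1) r', box s r))"
    proof (intro allI)
      fix r r'
      show "\<exists>f. (\<forall>s. f s \<noteq> 0 \<longrightarrow> r < height s \<and> r' < height (s + j)) \<and>
       (\<forall>s. r < height s \<longrightarrow> r' < height (s + j + 1) \<longrightarrow> f s - f (s + 1) = y $$ (box (s + j + 1) r', box s r))"
        using shift_surjective[OF strip_convex strip_convex strip_finite strip_nested j]
        unfolding strip_def mem_Collect_eq .
    qed
    then obtain f where f: "\<And>r r' s. f r r' s \<noteq> 0 \<Longrightarrow> r < height s \<and> r' < height (s + j)"
      "\<And>r r' s. r < height s \<Longrightarrow> r' < height (s + j + 1) \<Longrightarrow> f r r' s - f r r' (s + 1) = y $$ (box (s + j + 1) r', box s r)"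
      by metis
    define x where "x = mat n n (\<lambda>(p, q). if v p - v q = j then f (row q) (row p) (v q) else 0)"
    have x: "x \<in> diag_grading n v j" by (auto simp: x_def diag_grading_def)
    then have xc: "x \<in> carrier_mat n n" and yc: "y \<in> carrier_mat n n" using y by (auto simp: diag_grading_def)
    have bx: "boxed x (s + j) r' s r = f r r' s" for s r r'
      using f(1)[of r r' s] by (auto simp: boxed_def x_def box v_box row_box)
    have "bracket shift_matrix x \<in> diag_grading n v (j + 1)"
      using bracket_diag_grading[OF shift_matrix_grading x] by (simp add: add.commute)
    have "bracket shift_matrix x = y"
    proof (rule eq_matI)
      fix p q assume "p < dim_row y" "q < dim_col y"
      then have pq: "p < n" "q < n" using yc by auto
      show "bracket shift_matrix x $$ (p, q) = y $$ (p, q)"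
      proof (cases "v p - v q = j + 1")
        case True
        then have vp: "v p = v q + j + 1" by simp
        have "bracket shift_matrix x $$ (p, q) = f (row q) (row p) (v q) - f (row q) (row p) (v q + 1)"
          using bracket_shift_matrix_box[OF xc, of "row p" "v q" j "row q"] row[OF pq(1)] row[OF pq(2)] box_row[OF pq(1)] box_row[OF pq(2)]
          by (simp add: vp bx)
        also have "\<dots> = y $$ (p, q)"
          using f(2)[of "row q" "v q" "row p"] row[OF pq(1)] row[OF pq(2)] box_row[OF pq(1)] box_row[OF pq(2)] by (simp add: vp)
        finally show ?thesis .
      next
        case False
        then show ?thesis using diag_gradingD(2)[OF y pq] diag_gradingD(2)[OF \<open>bracket shift_matrix x \<in> diag_grading n v (j + 1)\<close> pq] by simp
      qed
    next
      show "dim_row (bracket shift_matrix x) = dim_row y" "dim_col (bracket shift_matrix x) = dim_col y"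
        using \<open>bracket shift_matrix x \<in> diag_grading n v (j + 1)\<close> yc by (auto simp: diag_grading_def)
    qed
    then show "y \<in> bracket shift_matrix ` diag_grading n v j" using x by blast
  qed
qed

lemma good_grading_pyramid: "good_grading n (diag_grading n v)"
  unfolding good_grading_def using gl_grading_diag shift_matrix_grading bracket_shift_matrix_inj bracket_shift_matrix_surj by blast

end

theorem good_grading_unimodal:
  assumes "unimodal (\<lambda>s. card {i. i < n \<and> v i = s}) t"
  shows "good_grading n (diag_grading n v)"
proof -
  define height where "height = (\<lambda>s. card {i. i < n \<and> v i = s})"
  \<comment> \<open>Within a column, any enumeration of its indices may serve as the assignment of
    rows.\<close>
  have "\<forall>s. \<exists>h. bij_betw h {0..<height s} {i. i < n \<and> v i = s}"
    unfolding height_def by (intro allI ex_bij_betw_nat_finite) auto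
  then obtain box where box: "\<And>s. bij_betw (box s) {0..<height s} {i. i < n \<and> v i = s}" by metis
  define row where "row = (\<lambda>i. inv_into {0..<height (v i)} (box (v i)) i)"
  interpret pyramid n v row box height t
  proof
    fix i assume "i < n"
    then have "i \<in> {k. k < n \<and> v k = v i}" by simp
    then show "row i < height (v i)" "box (v i) (row i) = i"
      using bij_betw_inv_into_right[OF box[of "v i"]] bij_betwE[OF bij_betw_inv_into[OF box[of "v i"]]]
      by (auto simp: row_def)
  next
    fix r s assume r: "r < height s"
    then show *: "box s r < n" "v (box s r) = s" using bij_betwE[OF box[of s]] by auto
    show "row (box s r) = r"
      using bij_betw_inv_into_left[OF box[of s], of r] r * by (simp add: row_def)
  next
    show "unimodal height t" using assms by (simp add: height_def)
  qed
  show ?thesis by (rule good_grading_pyramid)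
qed

section \<open>The principal element and Euclid's algorithm\<close>

text \<open>
  Vertices are numbered from 0 here. The top arcs of the meander join \<open>i\<close> to \<open>n - 1 - i\<close>, the bottom arcs join
  it to its mirror image in its own block.
\<close>
definition block_flip :: "nat \<Rightarrow> nat \<Rightarrow> nat \<Rightarrow> nat" where
  "block_flip a n i = (if i < a then a - 1 - i else n + a - 1 - i)"

definition arc :: "nat \<Rightarrow> nat \<Rightarrow> nat \<Rightarrow> nat \<Rightarrow> bool" where
  "arc a n p q \<longleftrightarrow> q = n - 1 - p \<and> p < q \<or> q = block_flip a n p \<and> q < p"

text \<open>The value $F([h, e_{p,q}])$ for the meander functional $F$.\<close>
definition arc_bracket :: "nat \<Rightarrow> nat \<Rightarrow> (nat \<Rightarrow> nat \<Rightarrow> complex) \<Rightarrow> nat \<Rightarrow> nat \<Rightarrow> complex" where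
  "arc_bracket a n h p q =
     (if n - 1 - q < q then h (n - 1 - q) p else 0) + (if q < block_flip a n q then h (block_flip a n q) p else 0)
   - (if p < n - 1 - p then h q (n - 1 - p) else 0) - (if block_flip a n p < p then h q (block_flip a n p) else 0)"

text \<open>The equations are imposed on all matrix units of the parabolic in gl_n. Functions
  without a trace condition are used because the descent restricts to a diagonal block, where the
  trace need not vanish.\<close>

definition principal_eq :: "nat \<Rightarrow> nat \<Rightarrow> (nat \<Rightarrow> nat \<Rightarrow> complex) \<Rightarrow> bool" where
  "principal_eq a n h \<longleftrightarrow>
     (\<forall>p<n. \<forall>q<n. a \<le> p \<and> q < a \<longrightarrow> h p q = 0) \<and>
     (\<forall>p<n. \<forall>q<n. (a \<le> p \<longrightarrow> a \<le> q) \<longrightarrow> arc_bracket a n h p q = of_bool (arc a n p q))"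

definition arc_diagonal :: "nat \<Rightarrow> nat \<Rightarrow> (nat \<Rightarrow> nat \<Rightarrow> complex) \<Rightarrow> bool" where
  "arc_diagonal a n h \<longleftrightarrow>
     (\<forall>p<n. \<forall>q<n. p \<noteq> q \<longrightarrow> h p q = 0) \<and> (\<forall>p<n. \<forall>q<n. arc a n p q \<longrightarrow> h p p - h q q = 1)"

lemma block_flip_less: "i < n \<Longrightarrow> a \<le> n \<Longrightarrow> block_flip a n i < n"
  by (auto simp: block_flip_def)

text \<open>Written through two involutions, the edges can be summed over a single vertex
  index.\<close>

lemma meander_edges_image:
  assumes "n = a + b"
  shows "meander_edges a b = (\<lambda>i. (Suc i, Suc (n - 1 - i))) ` {i. i < n \<and> i < n - 1 - i} \<union>
    (\<lambda>i. (Suc i, Suc (block_flip a n i))) ` {i. i < n \<and> block_flip a n i < i}" (is "_ = ?A \<union> ?B")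
proof -
  have "{(i, n + 1 - i) | i. 1 \<le> i \<and> i < n + 1 - i} = ?A"
  proof (intro equalityI subsetI)
    fix e assume "e \<in> {(i, n + 1 - i) | i. 1 \<le> i \<and> i < n + 1 - i}"
    then obtain i where "e = (i, n + 1 - i)" "1 \<le> i" "i < n + 1 - i" by blast
    then show "e \<in> ?A" by (intro image_eqI[of _ _ "i - 1"]) auto
  qed auto
  moreover have "{(a + 1 - i, i) | i. 1 \<le> i \<and> i < a + 1 - i} \<union>
     {(n + 1 - i, a + i) | i. 1 \<le> i \<and> a + i < n + 1 - i} = ?B"
  proof (intro equalityI subsetI)
    fix e assume "e \<in> {(a + 1 - i, i) | i. 1 \<le> i \<and> i < a + 1 - i} \<union>
     {(n + 1 - i, a + i) | i. 1 \<le> i \<and> a + i < n + 1 - i}"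
    then show "e \<in> ?B"
    proof
      assume "e \<in> {(a + 1 - i, i) | i. 1 \<le> i \<and> i < a + 1 - i}"
      then obtain i where "e = (a + 1 - i, i)" "1 \<le> i" "i < a + 1 - i" by blast
      then show "e \<in> ?B" using assms by (intro image_eqI[of _ _ "a - i"]) (auto simp: block_flip_def)
    next
      assume "e \<in> {(n + 1 - i, a + i) | i. 1 \<le> i \<and> a + i < n + 1 - i}"
      then obtain i where "e = (n + 1 - i, a + i)" "1 \<le> i" "a + i < n + 1 - i" by blast
      then show "e \<in> ?B" using assms by (intro image_eqI[of _ _ "n - i"]) (auto simp: block_flip_def)
    qed
  next
    fix e assume "e \<in> ?B"
    then obtain i where i: "e = (Suc i, Suc (block_flip a n i))" "i < n" "block_flip a n i < i" by blast
    show "e \<in> {(a + 1 - i, i) | i. 1 \<le> i \<and> i < a + 1 - i} \<union>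
     {(n + 1 - i, a + i) | i. 1 \<le> i \<and> a + i < n + 1 - i}"
    proof (cases "i < a")
      case True
      then have "e = (a + 1 - (a - i), a - i)" "1 \<le> a - i" "a - i < a + 1 - (a - i)"
        using i by (auto simp: block_flip_def)
      then show ?thesis by blast
    next
      case False
      then have "e = (n + 1 - (n - i), a + (n - i))" "1 \<le> n - i" "a + (n - i) < n + 1 - (n - i)"
        using i assms by (auto simp: block_flip_def)
      then show ?thesis by blast
    qed
  qed
  ultimately show ?thesis using assms unfolding meander_edges_def by (metis Un_assoc)
qed

lemma meander_functional_sum:
  assumes "n = a + b"
  shows "meander_functional a b X =
    (\<Sum>i<n. if i < n - 1 - i then X $$ (i, n - 1 - i) else 0) +
    (\<Sum>i<n. if block_flip a n i < i then X $$ (i, block_flip a n i) else 0)"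
proof -
  have "meander_functional a b X =
     (\<Sum>(i, j)\<in>(\<lambda>i. (Suc i, Suc (n - 1 - i))) ` {i. i < n \<and> i < n - 1 - i}. X $$ (i - 1, j - 1)) +
     (\<Sum>(i, j)\<in>(\<lambda>i. (Suc i, Suc (block_flip a n i))) ` {i. i < n \<and> block_flip a n i < i}. X $$ (i - 1, j - 1))"
    unfolding meander_functional_def meander_edges_image[OF assms]
    by (intro sum.union_disjoint) auto
  also have "\<dots> = (\<Sum>i | i < n \<and> i < n - 1 - i. X $$ (i, n - 1 - i)) + (\<Sum>i | i < n \<and> block_flip a n i < i. X $$ (i, block_flip a n i))"
    by (subst (1 2) sum.reindex) (auto simp: inj_on_def)
  also have "(\<Sum>i | i < n \<and> i < n - 1 - i. X $$ (i, n - 1 - i)) = (\<Sum>i<n. if i < n - 1 - i then X $$ (i, n - 1 - i) else 0)"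
    using sum.inter_filter[of "{..<n}" "\<lambda>i. X $$ (i, n - 1 - i)" "\<lambda>i. i < n - 1 - i"] by simp
  also have "(\<Sum>i | i < n \<and> block_flip a n i < i. X $$ (i, block_flip a n i)) = (\<Sum>i<n. if block_flip a n i < i then X $$ (i, block_flip a n i) else 0)"
    using sum.inter_filter[of "{..<n}" "\<lambda>i. X $$ (i, block_flip a n i)" "\<lambda>i. block_flip a n i < i"] by simp
  finally show ?thesis .
qed

lemma block_flip_involution: "i < n \<Longrightarrow> a \<le> n \<Longrightarrow> block_flip a n (block_flip a n i) = i"
  by (auto simp: block_flip_def)

lemma principal_element_eq:
  assumes a: "1 \<le> a" and n: "n = a + b"
    and H: "is_principal_element (parabolic a b) (meander_functional a b) H"
  shows "principal_eq a n (\<lambda>p q. H $$ (p, q))"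
proof -
  have Hp: "H \<in> parabolic a b" using H by (simp add: is_principal_element_def)
  then have Hc: "H \<in> carrier_mat n n" and low: "\<And>i j. i < n \<Longrightarrow> j < n \<Longrightarrow> a \<le> i \<and> j < a \<Longrightarrow> H $$ (i, j) = 0"
    using n by (auto simp: parabolic_def sl_def)
  have "arc_bracket a n (\<lambda>p q. H $$ (p, q)) p q = of_bool (arc a n p q)"
    if pq: "p < n" "q < n" "a \<le> p \<longrightarrow> a \<le> q" for p q
  proof -
    \<comment> \<open>Subtracting a multiple of the identity makes the matrix unit traceless and changes neither side.\<close>
    define y :: "complex mat" where
      "y = mat n n (\<lambda>(i, j). of_bool (i = p \<and> j = q) - (if i = j \<and> p = q then 1 / of_nat n else 0))"
    have yc: "y \<in> carrier_mat n n" by (simp add: y_def)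
    have yi: "y $$ (i, j) = of_bool (i = p \<and> j = q) - (if i = j \<and> p = q then 1 / of_nat n else 0)"
      if "i < n" "j < n" for i j using that by (simp add: y_def)
    have "(\<Sum>i<n. y $$ (i, i)) = (\<Sum>i<n. (if i = p then of_bool (p = q) else 0) - (if p = q then 1 / of_nat n else 0))"
      using yi by (intro sum.cong) auto
    also have "\<dots> = 0" using pq by (auto simp: sum_subtractf)
    finally have "y \<in> parabolic a b"
      using yc n pq unfolding parabolic_def sl_def by (auto simp: yi algebra_simps)
    then have F: "meander_functional a b y = meander_functional a b (bracket H y)"
      using H by (auto simp: is_principal_element_def)
    \<comment> \<open>The multiple of the identity is central and drops out. What remains is column
      \<open>p\<close> of \<open>H\<close> moved to column \<open>q\<close>, minus row
      \<open>q\<close> moved to row \<open>p\<close>.\<close>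
    have br: "bracket H y $$ (i, j) = (if j = q then H $$ (i, p) else 0) - (if i = p then H $$ (q, j) else 0)"
      if ij: "i < n" "j < n" for i j
    proof -
      have "(\<Sum>k<n. H $$ (i, k) * y $$ (k, j)) =
         (\<Sum>k<n. (if k = p then (if j = q then H $$ (i, p) else 0) else 0) - (if k = j then (if p = q then H $$ (i, j) / of_nat n else 0) else 0))"
        using ij by (intro sum.cong) (auto simp: yi algebra_simps)
      moreover have "(\<Sum>k<n. y $$ (i, k) * H $$ (k, j)) =
         (\<Sum>k<n. (if k = q then (if i = p then H $$ (q, j) else 0) else 0) - (if k = i then (if p = q then H $$ (i, j) / of_nat n else 0) else 0))"
        using ij by (intro sum.cong) (auto simp: yi algebra_simps)
      ultimately show ?thesis using bracket_index[OF Hc yc ij] pq ij by (simp add: sum_subtractf)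
    qed
    have an: "a \<le> n" using n by simp
    \<comment> \<open>The functional sees only arcs into \<open>q\<close> in the moved column and
      arcs out of \<open>p\<close> in the moved row; each involution gives at most one of
      either.\<close>
    have "meander_functional a b (bracket H y) =
      (\<Sum>i<n. (if i = n - 1 - q then (if n - 1 - q < q then H $$ (n - 1 - q, p) else 0) else 0) -
        (if i = p then (if p < n - 1 - p then H $$ (q, n - 1 - p) else 0) else 0)) +
      (\<Sum>i<n. (if i = block_flip a n q then (if q < block_flip a n q then H $$ (block_flip a n q, p) else 0) else 0) -
        (if i = p then (if block_flip a n p < p then H $$ (q, block_flip a n p) else 0) else 0))"
      unfolding meander_functional_sum[OF n]
    proof (intro arg_cong2[where f = "(+)"] sum.cong refl)
      fix i assume "i \<in> {..<n}"
      then have i: "i < n" by simp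
      have "n - 1 - i = q \<longleftrightarrow> i = n - 1 - q" "n - 1 - i < n" using i pq(2) by auto
      then show "(if i < n - 1 - i then bracket H y $$ (i, n - 1 - i) else 0) =
        (if i = n - 1 - q then (if n - 1 - q < q then H $$ (n - 1 - q, p) else 0) else 0) -
        (if i = p then (if p < n - 1 - p then H $$ (q, n - 1 - p) else 0) else 0)"
        using i by (auto simp: br)
      have "block_flip a n i = q \<longleftrightarrow> i = block_flip a n q" "block_flip a n i < n"
        using i pq(2) block_flip_less[OF i an] block_flip_involution[OF i an] block_flip_involution[OF pq(2) an] by auto
      then show "(if block_flip a n i < i then bracket H y $$ (i, block_flip a n i) else 0) =
        (if i = block_flip a n q then (if q < block_flip a n q then H $$ (block_flip a n q, p) else 0) else 0) -
        (if i = p then (if block_flip a n p < p then H $$ (q, block_flip a n p) else 0) else 0)"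
        using i block_flip_involution[OF pq(2) an] by (auto simp: br)
    qed
    also have "\<dots> = arc_bracket a n (\<lambda>p q. H $$ (p, q)) p q"
      using pq block_flip_less[OF pq(2) an] by (simp add: sum_subtractf arc_bracket_def)
    finally have 1: "meander_functional a b (bracket H y) = arc_bracket a n (\<lambda>p q. H $$ (p, q)) p q" .
    have "meander_functional a b y =
      (\<Sum>i<n. if i = p then of_bool (q = n - 1 - p \<and> p < q) else 0) +
      (\<Sum>i<n. if i = p then of_bool (q = block_flip a n p \<and> q < p) else 0)"
      unfolding meander_functional_sum[OF n] using pq block_flip_less[OF _ an]
      by (intro arg_cong2[where f = "(+)"] sum.cong) (auto simp: yi algebra_simps)
    also have "\<dots> = of_bool (arc a n p q)" using pq by (auto simp: arc_def)
    finally show ?thesis using F 1 by simp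
  qed
  then show ?thesis unfolding principal_eq_def using low by blast
qed


section \<open>Exchanging the two blocks\<close>

lemma block_flip_reverse: "i < n \<Longrightarrow> a \<le> n \<Longrightarrow> block_flip (n - a) n (n - 1 - i) = n - 1 - block_flip a n i"
  by (auto simp: block_flip_def)

text \<open>Reflection of the vertices swaps the blocks but also reverses the order, so source and
  target of an arc trade places.\<close>

lemma arc_reverse:
  assumes "p < n" and "q < n" and "a \<le> n"
  shows "arc (n - a) n p q \<longleftrightarrow> arc a n (n - 1 - q) (n - 1 - p)"
proof -
  define P Q where PQ: "P = n - 1 - q" "Q = n - 1 - p"
  then have PQ': "p = n - 1 - Q" "q = n - 1 - P" "P < n" "Q < n" using assms by auto
  have l: "block_flip a n Q < n" using block_flip_less[OF PQ'(4) assms(3)] .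
  have "block_flip (n - a) n p = n - 1 - block_flip a n Q" using block_flip_reverse[OF PQ'(4) assms(3)] PQ'(1) by simp
  then have "q = block_flip (n - a) n p \<longleftrightarrow> P = block_flip a n Q" using l PQ' by auto
  also have "\<dots> \<longleftrightarrow> Q = block_flip a n P" using block_flip_involution[of _ n a] PQ' assms(3) by auto
  finally have "q = block_flip (n - a) n p \<longleftrightarrow> Q = block_flip a n P" .
  moreover have "q < p \<longleftrightarrow> Q < P" "p < q \<longleftrightarrow> P < Q" "q = n - 1 - p \<longleftrightarrow> Q = n - 1 - P" using PQ' by auto
  ultimately show ?thesis unfolding arc_def PQ[symmetric] by simp
qed

text \<open>The map $h \mapsto -J h^T J$, with $J$ the antidiagonal matrix, exchanges the roles of $a$ and $b$.\<close>
lemma principal_eq_reverse: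
  assumes h: "principal_eq a n h" and an: "a \<le> n"
  shows "principal_eq (n - a) n (\<lambda>p q. - h (n - 1 - q) (n - 1 - p))" (is "principal_eq _ _ ?h")
  unfolding principal_eq_def
proof (intro conjI allI impI)
  fix p q assume pq: "p < n" "q < n" "n - a \<le> p \<and> q < n - a"
  then have "n - 1 - q < n" "n - 1 - p < n" "a \<le> n - 1 - q" "n - 1 - p < a" by auto
  then show "?h p q = 0" using h by (simp add: principal_eq_def)
next
  fix p q assume pq: "p < n" "q < n" "n - a \<le> p \<longrightarrow> n - a \<le> q"
  define P Q where PQ: "P = n - 1 - q" "Q = n - 1 - p"
  then have PQ': "p = n - 1 - Q" "q = n - 1 - P" "P < n" "Q < n" "a \<le> P \<longrightarrow> a \<le> Q" using pq by auto
  have r: "block_flip (n - a) n p = n - 1 - block_flip a n Q" "block_flip (n - a) n q = n - 1 - block_flip a n P"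
    using block_flip_reverse PQ' an by auto
  have l: "block_flip a n Q < n" "block_flip a n P < n" using block_flip_less PQ' an by auto
  have "arc_bracket (n - a) n ?h p q = arc_bracket a n h P Q"
    unfolding arc_bracket_def r using PQ'(3,4) l pq(1,2) by (auto simp: PQ'(1,2))
  also have "\<dots> = of_bool (arc a n P Q)" using h PQ' by (auto simp: principal_eq_def)
  finally show "arc_bracket (n - a) n ?h p q = of_bool (arc (n - a) n p q)"
    using arc_reverse[OF pq(1,2) an] by (simp add: PQ)
qed

lemma arc_diagonal_reverse:
  assumes h: "arc_diagonal a n h" and an: "a \<le> n"
  shows "arc_diagonal (n - a) n (\<lambda>p q. - h (n - 1 - q) (n - 1 - p))" (is "arc_diagonal _ _ ?h")
  unfolding arc_diagonal_def
proof (intro conjI allI impI)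
  fix p q assume pq: "p < n" "q < n" "p \<noteq> q"
  then have "n - 1 - q < n" "n - 1 - p < n" "n - 1 - q \<noteq> n - 1 - p" by auto
  then show "?h p q = 0" using h by (simp add: arc_diagonal_def)
next
  fix p q assume pq: "p < n" "q < n" "arc (n - a) n p q"
  then have "n - 1 - q < n" "n - 1 - p < n" "arc a n (n - 1 - q) (n - 1 - p)" using arc_reverse an by auto
  then have "h (n - 1 - q) (n - 1 - q) - h (n - 1 - p) (n - 1 - p) = 1" using h unfolding arc_diagonal_def by blast
  then show "?h p p - ?h q q = 1" by simp
qed

section \<open>The balanced case and Euclid's step\<close>

text \<open>If $a > 1$ then $0, n - 1, a, a - 1$ form a closed path of arcs, around which the levels cannot be consistent.\<close>
lemma principal_eq_balanced:
  assumes h: "principal_eq a (2 * a) h" and a: "1 \<le> a"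
  shows "a = 1"
proof (rule ccontr)
  assume "a \<noteq> 1"
  then obtain m where m: "a = Suc m" "0 < m" using a by (cases a) auto
  obtain N where N: "N = 2 * m + 1" by simp
  have n: "2 * a = Suc N" using m N by simp
  have eq: "arc_bracket (Suc m) (Suc N) h p q = of_bool (arc (Suc m) (Suc N) p q)"
    if "p < Suc N" "q < Suc N" "Suc m \<le> p \<longrightarrow> Suc m \<le> q" for p q
    using h that unfolding principal_eq_def n by (simp add: m)
  have flip: "block_flip (Suc m) (Suc N) 0 = m" "block_flip (Suc m) (Suc N) m = 0"
    "block_flip (Suc m) (Suc N) (Suc m) = N" "block_flip (Suc m) (Suc N) N = Suc m"
    using m N by (auto simp: block_flip_def)
  have sub: "N - m = Suc m" "N - Suc m = m" and less: "m < N" "Suc m < N" "0 < N"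
    using m N by auto
  have low: "h p q = 0" if "p \<in> {Suc m, N}" "q \<in> {0, m}" for p q
    using h that m N unfolding principal_eq_def n by auto
  note simps = arc_bracket_def arc_def flip sub less m(2) low
  \<comment> \<open>The six equations make the level drop from m to m + 1 equal to 1 along the
    direct arc, but 3 along the arcs through 0 and N.\<close>
  have "h 0 0 - h N N = 1" using eq[of 0 N] less m(2) by (simp add: simps)
  moreover have "h m m - h (Suc m) (Suc m) = 1" using eq[of m "Suc m"] less m(2) by (simp add: simps)
  moreover have "h m m - h 0 (Suc m) - h 0 0 = 1" using eq[of m 0] less m(2) by (simp add: simps)
  moreover have "h 0 (Suc m) = 0" using eq[of "Suc m" N] less m(2) by (simp add: simps)
  moreover have "h m N + h N N - h (Suc m) (Suc m) = 1" using eq[of N "Suc m"] less m(2) by (simp add: simps)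
  moreover have "h m N = 0" using eq[of 0 m] less m(2) by (simp add: simps)
  ultimately have "(1::complex) + 1 = 0" by (simp add: algebra_simps)
  then show False by simp
qed

text \<open>This is the equation at the matrix unit in row i and column n - 1 - j. Its bottom-arc
  terms lie in the zero block, leaving two top-arc terms. Thus the first block is the reflected last
  corner plus the identity, and the zero block required of the smaller parabolic appears.\<close>

lemma principal_eq_off:
  assumes h: "principal_eq a (a + b) h" and ab: "a < b" and i: "i < a" and j: "j < b"
  shows "a \<le> j \<Longrightarrow> h (a + b - 1 - j) (a + b - 1 - i) = 0"
    and "j < a \<Longrightarrow> h j i - h (a + b - 1 - j) (a + b - 1 - i) = of_bool (i = j)"
proof -
  define n where "n = a + b"
  define P Q R where "P = n - 1 - j" and "Q = n - 1 - i" and "R = a - 1 - i"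
  have bounds: "a \<le> P" "P < n" "i < Q" "n - 1 - P = j" "n - 1 - i = Q" "a + j < n" "R < a" "\<not> P < i" "i \<noteq> P"
    and less: "j < P \<or> a \<le> j"
    using ab i j by (auto simp: n_def P_def Q_def R_def)
  have flip: "block_flip a n i = R" "block_flip a n P = a + j"
    using i j ab by (auto simp: block_flip_def n_def P_def R_def)
  have low: "h p q = 0" if "a \<le> p" "p < n" "q < a" for p q
    using h that by (auto simp: principal_eq_def n_def)
  have arc: "arc a n i P \<longleftrightarrow> i = j"
    using i j ab less bounds by (auto simp: arc_def flip n_def P_def R_def)
  have "arc_bracket a n h i P = of_bool (arc a n i P)"
    using h i bounds by (auto simp: principal_eq_def n_def)
  then have eq: "(if j < P then h j i else 0) - h P Q = of_bool (i = j)"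
    unfolding arc_bracket_def arc bounds flip using bounds i low[of "a + j" i] low[of P R]
    by (simp cong: if_cong)
  show "h (a + b - 1 - j) (a + b - 1 - i) = 0" if "a \<le> j"
    using eq that i j low[of j i] by (auto simp: P_def Q_def n_def split: if_splits)
  show "h j i - h (a + b - 1 - j) (a + b - 1 - i) = of_bool (i = j)" if "j < a"
    using eq that less by (simp add: P_def Q_def n_def)
qed


text \<open>
  Euclid's step. The top arcs starting in the first block identify it with the last \<open>a\<close> vertices of the second
  block; contracting them moves the bottom arcs of the first block there, and after reversing the order
  the meander of $(a, b - a)$ appears.
\<close>
lemma principal_eq_step:
  assumes h: "principal_eq a (a + b) h" and ab: "a < b"
  shows "principal_eq a b (\<lambda>i j. h (a + b - 1 - i) (a + b - 1 - j))" (is "principal_eq _ _ ?h")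
  unfolding principal_eq_def
proof (intro conjI allI impI)
  fix p q assume "p < b" "q < b" "a \<le> p \<and> q < a"
  then show "?h p q = 0" using principal_eq_off(1)[OF h ab, of q p] by simp
next
  fix i j assume ij: "i < b" "j < b" "a \<le> i \<longrightarrow> a \<le> j"
  define n p q where "n = a + b" and "p = n - 1 - i" and "q = n - 1 - j"
  have pq: "p < n" "q < n" "a \<le> p" "a \<le> q" using ij by (auto simp: n_def p_def q_def)
  have eq: "arc_bracket a n h p q = of_bool (arc a n p q)"
    using h pq by (auto simp: principal_eq_def n_def)
  have t: "n - 1 - p = i" "n - 1 - q = j" and f: "block_flip a n p = a + i" "block_flip a n q = a + j"
    using ij pq by (auto simp: n_def p_def q_def block_flip_def)
  have bf: "n - 1 - (b - 1 - j) = a + j" "n - 1 - (b - 1 - i) = a + i" using ij by (auto simp: n_def)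
  have c: "b - 1 - j < j \<longleftrightarrow> q < a + j" "i < b - 1 - i \<longleftrightarrow> a + i < p" using ij by (auto simp: n_def p_def q_def)
  show "arc_bracket a b ?h i j = of_bool (arc a b i j)"
  proof (cases "a \<le> j")
    case aj: True
    have fj: "block_flip a b j = q" using aj ij by (auto simp: block_flip_def q_def n_def)
    show ?thesis
    proof (cases "a \<le> i")
      case True
      have fi: "block_flip a b i = p" using True ij by (auto simp: block_flip_def p_def n_def)
      have "arc_bracket a b ?h i j = arc_bracket a n h p q"
        unfolding arc_bracket_def t f fi fj n_def[symmetric] bf c unfolding p_def[symmetric] q_def[symmetric] t by simp
      moreover have "arc a b i j \<longleftrightarrow> arc a n p q"
        unfolding arc_def t f fi using ij by (auto simp: p_def q_def n_def)
      ultimately show ?thesis using eq by simp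
    next
      case False
      then have fi: "block_flip a b i = a - 1 - i" "n - 1 - (a - 1 - i) = b + i"
        using ij by (auto simp: block_flip_def n_def)
      \<comment> \<open>This entry belongs to the bottom arc at \<open>i\<close> in the smaller
        meander. The larger equation has no counterpart, as the top arc at \<open>p\<close> points
        into \<open>p\<close>.\<close>
      have "h q (b + i) = 0"
        using principal_eq_off(1)[OF h ab, of "a - 1 - i" j] False aj ij fi(2) by (simp add: n_def q_def)
      moreover have "i < p" using False ab by (simp add: p_def n_def)
      ultimately have "arc_bracket a b ?h i j = arc_bracket a n h p q"
        unfolding arc_bracket_def t f fi fj n_def[symmetric] bf c unfolding p_def[symmetric] q_def[symmetric] t
        by simp
      moreover have "arc a b i j \<longleftrightarrow> arc a n p q"
        unfolding arc_def t f fi using ij False aj by (auto simp: p_def q_def n_def)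
      ultimately show ?thesis using eq by simp
    qed
  next
    \<comment> \<open>Both vertices lie in the contracted block. The equations at (i, j) and (p, q)
      contain the cross term \<open>h j p\<close> with opposite signs; their sum eliminates it, and
      \<open>principal_eq_off\<close> moves the remaining entries to the second block.\<close>
    case aj: False
    with ij have ai: "i < a" "j < a" by auto
    define i' j' where "i' = a - 1 - i" and "j' = a - 1 - j"
    have f': "block_flip a b i = i'" "block_flip a b j = j'" "block_flip a n i = i'" "block_flip a n j = j'"
      using ai by (auto simp: block_flip_def i'_def j'_def)
    have t': "n - 1 - i' = b + i" "n - 1 - j' = b + j" "n - 1 - i = p" "n - 1 - j = q"
      using ai by (auto simp: i'_def j'_def n_def p_def q_def)
    have less: "i < p" "\<not> p < i" "\<not> q < j" "j < q" "j \<noteq> p" using ai ab by (auto simp: p_def q_def n_def)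
    have "arc_bracket a n h i j = of_bool (arc a n i j)"
      using h ai ab by (auto simp: principal_eq_def n_def)
    then have top: "(if j < j' then h j' i else 0) - h j p - (if i' < i then h j i' else 0) = of_bool (j = i' \<and> j < i)"
      unfolding arc_bracket_def arc_def t' f' using less by simp
    have l: "h j' i - h (b + j) p = of_bool (i = j')" "h j i' - h q (b + i) = of_bool (i' = j)"
      using principal_eq_off(2)[OF h ab, of i j'] principal_eq_off(2)[OF h ab, of i' j] ai ab t'
      by (auto simp: i'_def j'_def n_def)
    have ij': "i = j' \<longleftrightarrow> i' = j" using ai by (auto simp: i'_def j'_def)
    have "arc a n p q \<longleftrightarrow> j = b - 1 - i \<and> i < j"
      unfolding arc_def t f using ai ab by (auto simp: p_def q_def n_def)
    then have bot: "h j p + (if q < a + j then h (a + j) p else 0) - (if a + i < p then h q (a + i) else 0)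
       = of_bool (j = b - 1 - i \<and> i < j)"
      using eq less unfolding arc_bracket_def t f by simp
    \<comment> \<open>The Kronecker deltas in \<open>l\<close> are nonzero only for
      \<open>i' = j\<close>, where both conditions read j < i, so they cancel.\<close>
    have mid: "(if j < j' then h (b + j) p else 0) - (if i' < i then h q (b + i) else 0) =
        h j p + of_bool (j = i' \<and> j < i)"
    proof (cases "i' = j")
      case True
      then show ?thesis using top l ij' by (auto simp: algebra_simps split: if_splits)
    next
      case False
      then have "h (b + j) p = h j' i" "h q (b + i) = h j i'" using l ij' by auto
      then show ?thesis using top False by (auto simp: algebra_simps split: if_splits)
    qed
    have "arc_bracket a b ?h i j = (if q < a + j then h (a + j) p else 0) - (if a + i < p then h q (a + i) else 0)
      + ((if j < j' then h (b + j) p else 0) - (if i' < i then h q (b + i) else 0))"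
      unfolding arc_bracket_def f' n_def[symmetric] bf c t' by (simp only: algebra_simps)
    also have "\<dots> = (h j p + (if q < a + j then h (a + j) p else 0) - (if a + i < p then h q (a + i) else 0))
      + of_bool (j = i' \<and> j < i)"
      unfolding mid by (simp only: algebra_simps)
    also have "\<dots> = of_bool (j = b - 1 - i \<and> i < j) + of_bool (j = i' \<and> j < i)"
      unfolding bot ..
    also have "\<dots> = of_bool (arc a b i j)" by (auto simp: arc_def f')
    finally show ?thesis .
  qed
qed

text \<open>The second block is diagonal by assumption, and \<open>principal_eq_off\<close> copies
  this to the first. In the upper right block, the equations in the first block isolate the entries
  of the last a columns (\<open>topA\<close>), and equations in the second block those of the other
  columns (\<open>topB\<close>).\<close>

lemma arc_diagonal_step:
  assumes h: "principal_eq a (a + b) h" and ab: "a < b"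
    and d: "arc_diagonal a b (\<lambda>i j. h (a + b - 1 - i) (a + b - 1 - j))"
  shows "arc_diagonal a (a + b) h" and "i < a \<Longrightarrow> h i i = h (a + b - 1 - i) (a + b - 1 - i) + 1"
proof -
  define n where "n = a + b"
  have dd: "h p q = 0" if "a \<le> p" "a \<le> q" "p < n" "q < n" "p \<noteq> q" for p q
  proof -
    have "n - 1 - p < b" "n - 1 - q < b" "n - 1 - p \<noteq> n - 1 - q" "n - 1 - (n - 1 - p) = p" "n - 1 - (n - 1 - q) = q"
      using that by (auto simp: n_def)
    then show ?thesis using d unfolding arc_diagonal_def n_def[symmetric] by metis
  qed
  have da: "h (n - 1 - i) (n - 1 - i) - h (n - 1 - j) (n - 1 - j) = 1" if "i < b" "j < b" "arc a b i j" for i j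
    using d that by (auto simp: arc_diagonal_def n_def)
  have off: "h j i - h (n - 1 - j) (n - 1 - i) = of_bool (i = j)" if "i < a" "j < a" for i j
    using principal_eq_off(2)[OF h ab] that ab by (simp add: n_def)
  have aa: "h j i = 0" if "i < a" "j < a" "i \<noteq> j" for i j
  proof -
    have "h (n - 1 - j) (n - 1 - i) = 0" using that ab by (intro dd) (auto simp: n_def)
    then show ?thesis using off[OF that(1,2)] that by simp
  qed
  have ai: "h i i = h (n - 1 - i) (n - 1 - i) + 1" if "i < a" for i
    using off[OF that that] by (simp add: algebra_simps)
  then show "i < a \<Longrightarrow> h i i = h (a + b - 1 - i) (a + b - 1 - i) + 1" by (simp add: n_def)
  have arcA: "h i i - h j j = 1" if "i < a" "j = a - 1 - i" "j < i" for i j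
  proof -
    have "arc a b i j" using that by (simp add: arc_def block_flip_def)
    then show ?thesis using da[of i j] ai[of i] ai[of j] that ab by simp
  qed
  have topA: "h j (n - 1 - i) = 0" if ij: "i < a" "j < a" for i j
  proof -
    define i' j' where "i' = a - 1 - i" and "j' = a - 1 - j"
    have f: "block_flip a n i = i'" "block_flip a n j = j'" and l: "i' < a" "j' < a" "i < n - 1 - i" "\<not> n - 1 - j < j" "j \<noteq> n - 1 - i"
      using ij ab by (auto simp: block_flip_def i'_def j'_def n_def)
    have "arc_bracket a n h i j = of_bool (arc a n i j)"
      using h ij ab by (auto simp: principal_eq_def n_def)
    then have eq: "(if j < j' then h j' i else 0) - h j (n - 1 - i) - (if i' < i then h j i' else 0) = of_bool (j = i' \<and> j < i)"
      unfolding arc_bracket_def arc_def f using l by simp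
    show ?thesis
    proof (cases "j = i'")
      case True
      then have "j' = i" using ij by (auto simp: i'_def j'_def)
      moreover have "h i i = h j j + 1" if "j < i"
        using arcA[of i j] that True ij by (simp add: i'_def algebra_simps)
      ultimately show ?thesis using eq True[symmetric] by (cases "j < i") auto
    next
      case False
      then have "j' \<noteq> i" using ij by (auto simp: i'_def j'_def)
      then show ?thesis using eq False aa[of i j'] aa[of i' j] ij l by (auto split: if_splits)
    qed
  qed
  have topB: "h x p = 0" if xp: "x < a" "a \<le> p" "p < b" for x p
  proof -
    define q where "q = n - 1 - x"
    have q: "n - 1 - q = x" "b \<le> q" "q < n" "x < q" "a \<le> q" using xp ab by (auto simp: q_def n_def)
    have f: "block_flip a n q = a + x" "block_flip a n p = n + a - 1 - p" using xp q ab by (auto simp: block_flip_def q_def n_def)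
    have m: "a \<le> n - 1 - p" "n - 1 - p < b" "a + x < n" "n + a - 1 - p < n" "a \<le> n + a - 1 - p" using xp ab by (auto simp: n_def)
    have "arc_bracket a n h p q = of_bool (arc a n p q)"
      using h xp q by (auto simp: principal_eq_def n_def)
    then have "h x p + (if q < a + x then h (a + x) p else 0) - (if p < n - 1 - p then h q (n - 1 - p) else 0)
       - (if n + a - 1 - p < p then h q (n + a - 1 - p) else 0) = of_bool (arc a n p q)"
      unfolding arc_bracket_def f q(1) using q by simp
    moreover have "q < a + x \<Longrightarrow> h (a + x) p = 0" using dd[of "a + x" p] xp q m by auto
    moreover have "h q (n - 1 - p) = 0" using dd[of q "n - 1 - p"] q m by auto
    moreover have "n + a - 1 - p < p \<Longrightarrow> h q (n + a - 1 - p) = 0" using dd[of q "n + a - 1 - p"] q m xp by auto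
    moreover have "\<not> arc a n p q" unfolding arc_def f using q m xp by auto
    ultimately show ?thesis by (auto split: if_splits)
  qed
  show "arc_diagonal a (a + b) h"
    unfolding arc_diagonal_def n_def[symmetric]
  proof (intro conjI allI impI)
    fix p q assume pq: "p < n" "q < n" "p \<noteq> q"
    consider "a \<le> p" "q < a" | "a \<le> p" "a \<le> q" | "p < a" "q < a" | "p < a" "a \<le> q" "q < b" | "p < a" "b \<le> q" by linarith
    then show "h p q = 0"
    proof cases
      case 1
      then show ?thesis using h pq by (auto simp: principal_eq_def n_def)
    next
      case 2
      then show ?thesis using dd pq by blast
    next
      case 3
      then show ?thesis using aa pq by blast
    next
      case 4
      then show ?thesis using topB by blast
    next
      case 5
      then have "n - 1 - q < a" "n - 1 - (n - 1 - q) = q" using pq by (auto simp: n_def)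
      then show ?thesis using topA[of "n - 1 - q" p] 5 by simp
    qed
  next
    fix p q assume pq: "p < n" "q < n" "arc a n p q"
    consider "q = n - 1 - p" "p < a" | "q = n - 1 - p" "a \<le> p" "p < q" | "p < a" "q = a - 1 - p" "q < p"
      | "a \<le> p" "q = n + a - 1 - p" "q < p"
      using pq unfolding arc_def block_flip_def by (auto split: if_splits)
    then show "h p p - h q q = 1"
    proof cases
      case 1
      then show ?thesis using ai[of p] by simp
    next
      case 2
      \<comment> \<open>Reversal exchanges the ends of a top arc, so it becomes a bottom arc of the
        smaller meander running from \<open>q\<close> to \<open>p\<close>.\<close>
      then have "arc a b q p" "n - 1 - q = p" "n - 1 - p = q" "q < b" "p < b"
        using pq by (auto simp: arc_def block_flip_def n_def)
      then show ?thesis using da[of q p] by simp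
    next
      case 3
      then show ?thesis using arcA by blast
    next
      case 4
      then have "arc a b (n - 1 - p) (n - 1 - q)" "n - 1 - (n - 1 - q) = q" "n - 1 - (n - 1 - p) = p" "n - 1 - q < b" "n - 1 - p < b"
        using pq by (auto simp: arc_def n_def)
      then show ?thesis using da[of "n - 1 - p" "n - 1 - q"] by simp
    qed
  qed
qed

section \<open>Words for the eigenvalue multiplicities\<close>

text \<open>With \<open>rear\<close> these are the components of M (z, 1)^T, that is, the pair (p,
  q) that Euclid's steps produce from (z, 1).\<close>

definition front :: "bool list \<Rightarrow> int \<Rightarrow> int" where
  "front w i = entry w True True (i - 1) + entry w True False i"

definition rear :: "bool list \<Rightarrow> int \<Rightarrow> int" where
  "rear w i = entry w False True (i - 1) + entry w False False i"

lemma fence_eq: "fence w i = front w i + rear w i"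
  by (simp add: fence_def front_def rear_def)

lemma front_rear_Cons:
  "front (True # w) i = front w (i - 1)" "rear (True # w) i = front w i + rear w i"
  "front (False # w) i = front w i + rear w i" "rear (False # w) i = rear w (i + 1)"
  by (simp_all add: front_def rear_def)

text \<open>Replacing z by 1/z and swapping the coordinates exchanges the two letters; the extra
  factor z preserves the starting pair (z, 1).\<close>

lemma front_rear_Not: "front (map Not w) i = rear w (1 - i)" "rear (map Not w) i = front w (1 - i)"
proof (induction w arbitrary: i)
  case Nil
  { case 1 show ?case by (auto simp: front_def rear_def) }
  { case 2 show ?case by (auto simp: front_def rear_def) }
next
  case (Cons x w)
  { case 1 show ?case by (cases x) (simp_all add: front_rear_Cons Cons.IH algebra_simps) }
  { case 2 show ?case by (cases x) (simp_all add: front_rear_Cons Cons.IH algebra_simps) }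
qed

text \<open>The two blocks are counted separately because Euclid's step acts on the pair and not on
  its sum.\<close>

definition meander_levels :: "nat \<Rightarrow> nat \<Rightarrow> (nat \<Rightarrow> nat \<Rightarrow> complex) \<Rightarrow> bool" where
  "meander_levels a b h \<longleftrightarrow> arc_diagonal a (a + b) h \<and>
     (\<exists>w \<kappa> v. (\<forall>i<a + b. h i i = \<kappa> + of_int (v i)) \<and>
        (\<forall>s. int (card {i. i < a \<and> v i = s}) = front w s) \<and>
        (\<forall>s. int (card {i. a \<le> i \<and> i < a + b \<and> v i = s}) = rear w s))"

lemma card_reflect: "card {i. i < n \<and> Q (n - 1 - i)} = card {j. j < (n::nat) \<and> Q j}"
  by (rule bij_betw_same_card[of "\<lambda>i. n - 1 - i"], rule bij_betw_byWitness[where f' = "\<lambda>i. n - 1 - i"]) auto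

text \<open>The first block copies that of the smaller meander one level higher, while the second
  block is the whole smaller meander. This is (p, q) to (z p, p + q), so the word gains the letter
  \<open>True\<close>.\<close>

lemma meander_levels_step:
  assumes h: "principal_eq a (a + b) h" and ab: "a < b"
    and lev: "meander_levels a (b - a) (\<lambda>i j. h (a + b - 1 - i) (a + b - 1 - j))"
  shows "meander_levels a b h"
proof -
  define n where "n = a + b"
  have b: "a + (b - a) = b" using ab by simp
  note lev = lev[unfolded meander_levels_def b]
  then have d: "arc_diagonal a b (\<lambda>i j. h (a + b - 1 - i) (a + b - 1 - j))" by blast
  note step = arc_diagonal_step[OF h ab d]
  obtain w \<kappa> v where v: "\<And>i. i < b \<Longrightarrow> h (n - 1 - i) (n - 1 - i) = \<kappa> + of_int (v i)"
    and front: "\<And>s. int (card {i. i < a \<and> v i = s}) = front w s"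
    and rear: "\<And>s. int (card {i. a \<le> i \<and> i < b \<and> v i = s}) = rear w s"
    using lev unfolding n_def by blast
  define v' where "v' = (\<lambda>i. if i < a then v i + 1 else v (n - 1 - i))"
  have "h i i = \<kappa> + of_int (v' i)" if "i < n" for i
  proof (cases "i < a")
    case True
    then show ?thesis using step(2)[OF True] v[of i] ab by (simp add: v'_def n_def)
  next
    case False
    then have "n - 1 - i < b" "n - 1 - (n - 1 - i) = i" using that by (auto simp: n_def)
    then show ?thesis using v[of "n - 1 - i"] False by (simp add: v'_def)
  qed
  moreover have "int (card {i. i < a \<and> v' i = s}) = front (True # w) s" for s
  proof -
    have "{i. i < a \<and> v' i = s} = {i. i < a \<and> v i = s - 1}" by (auto simp: v'_def)
    then show ?thesis using front by (simp add: front_rear_Cons)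
  qed
  moreover have "int (card {i. a \<le> i \<and> i < n \<and> v' i = s}) = rear (True # w) s" for s
  proof -
    have "{i. a \<le> i \<and> i < n \<and> v' i = s} = {i. i < n \<and> (n - 1 - i < b \<and> v (n - 1 - i) = s)}"
      by (auto simp: v'_def n_def)
    then have "card {i. a \<le> i \<and> i < n \<and> v' i = s} = card {i. i < n \<and> (i < b \<and> v i = s)}"
      using card_reflect[of n "\<lambda>i. i < b \<and> v i = s"] by simp
    also have "{i. i < n \<and> (i < b \<and> v i = s)} = {i. i < a \<and> v i = s} \<union> {i. a \<le> i \<and> i < b \<and> v i = s}"
      using ab by (auto simp: n_def)
    also have "card \<dots> = card {i. i < a \<and> v i = s} + card {i. a \<le> i \<and> i < b \<and> v i = s}"
      by (intro card_Un_disjoint) auto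
    finally show ?thesis using front rear by (simp add: front_rear_Cons)
  qed
  ultimately show ?thesis using step(1) unfolding meander_levels_def n_def by blast
qed

lemma meander_levels_reverse:
  assumes lev: "meander_levels b a (\<lambda>p q. - h (a + b - 1 - q) (a + b - 1 - p))" (is "meander_levels _ _ ?h")
  shows "meander_levels a b h"
proof -
  define n where "n = a + b"
  have n: "b + a = n" "n - b = a" "b \<le> n" by (simp_all add: n_def)
  note lev = lev[unfolded meander_levels_def n n_def[symmetric]]
  then have "arc_diagonal b n (\<lambda>p q. - h (n - 1 - q) (n - 1 - p))" by blast
  from arc_diagonal_reverse[OF this n(3)] have "arc_diagonal a n h"
    unfolding arc_diagonal_def n(2) by simp
  obtain w \<kappa> v where v: "\<And>i. i < n \<Longrightarrow> - h (n - 1 - i) (n - 1 - i) = \<kappa> + of_int (v i)"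
    and front: "\<And>s. int (card {i. i < b \<and> v i = s}) = front w s"
    and rear: "\<And>s. int (card {i. b \<le> i \<and> i < n \<and> v i = s}) = rear w s"
    using lev by blast
  \<comment> \<open>The reflection negates the levels. The offset 1 matches
    \<open>front_rear_Not\<close> and is compensated in the constant.\<close>
  define v' where "v' = (\<lambda>i. 1 - v (n - 1 - i))"
  have "h i i = (- \<kappa> - 1) + of_int (v' i)" if "i < n" for i
  proof -
    have "n - 1 - i < n" "n - 1 - (n - 1 - i) = i" using that by auto
    then have "- h i i = \<kappa> + of_int (v (n - 1 - i))" using v[of "n - 1 - i"] by simp
    then have "h i i = - (\<kappa> + of_int (v (n - 1 - i)))" by (metis minus_minus)
    then show ?thesis by (simp add: v'_def)
  qed
  moreover have "int (card {i. i < a \<and> v' i = s}) = front (map Not w) s" for s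
  proof -
    have "{i. i < a \<and> v' i = s} = {i. i < n \<and> (b \<le> n - 1 - i \<and> v (n - 1 - i) = 1 - s)}"
      by (auto simp: v'_def n_def)
    also have "card \<dots> = card {i. i < n \<and> (b \<le> i \<and> v i = 1 - s)}" by (rule card_reflect)
    also have "{i. i < n \<and> (b \<le> i \<and> v i = 1 - s)} = {i. b \<le> i \<and> i < n \<and> v i = 1 - s}" by auto
    finally show ?thesis using rear by (simp add: front_rear_Not)
  qed
  moreover have "int (card {i. a \<le> i \<and> i < n \<and> v' i = s}) = rear (map Not w) s" for s
  proof -
    have "{i. a \<le> i \<and> i < n \<and> v' i = s} = {i. i < n \<and> (n - 1 - i < b \<and> v (n - 1 - i) = 1 - s)}"
      by (auto simp: v'_def n_def)
    also have "card \<dots> = card {i. i < n \<and> (i < b \<and> v i = 1 - s)}" by (rule card_reflect)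
    also have "{i. i < n \<and> (i < b \<and> v i = 1 - s)} = {i. i < b \<and> v i = 1 - s}" by (auto simp: n_def)
    finally show ?thesis using front by (simp add: front_rear_Not)
  qed
  ultimately show ?thesis using \<open>arc_diagonal a n h\<close> unfolding meander_levels_def n_def by blast
qed

lemma meander_levels_one:
  assumes h: "principal_eq 1 2 h"
  shows "meander_levels 1 1 h"
proof -
  have eq: "arc_bracket 1 2 h p q = of_bool (arc 1 2 p q)" if "p < 2" "q < 2" "1 \<le> p \<longrightarrow> 1 \<le> q" for p q
    using h that unfolding principal_eq_def by blast
  have ev: "arc_bracket 1 2 h 0 1 = h 0 0 - h 1 1" "arc 1 2 0 1" "arc_bracket 1 2 h 1 1 = h 0 1"
    "\<not> arc 1 2 1 1" "\<not> arc 1 2 0 0" "\<not> arc 1 2 1 0"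
    by (simp_all add: arc_bracket_def arc_def block_flip_def)
  have 1: "h 0 0 - h 1 1 = 1" and 2: "h 0 1 = 0" using eq[of 0 1] eq[of 1 1] ev by simp_all
  have 3: "h 1 0 = 0" using h unfolding principal_eq_def by auto
  have below2: "i < 2 \<longleftrightarrow> i = 0 \<or> i = 1" for i :: nat by auto
  have "arc_diagonal 1 2 h"
    unfolding arc_diagonal_def below2 using 1 2 3 ev by auto
  \<comment> \<open>Levels 1 and 0 give the starting pair (z, 1), hence the empty word.\<close>
  define u :: "nat \<Rightarrow> int" where "u = (\<lambda>i. if i = 0 then 1 else 0)"
  have "\<forall>i<2. h i i = h 1 1 + of_int (u i)"
    unfolding below2 u_def using 1 by (auto simp: algebra_simps)
  moreover have "int (card {i. i < 1 \<and> u i = s}) = front [] s" for s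
  proof -
    have "card {i. i < 1 \<and> u i = s} = card (if s = 1 then {0 :: nat} else {})"
      by (rule arg_cong[where f = card]) (auto simp: u_def)
    then show ?thesis by (simp add: front_def)
  qed
  moreover have "int (card {i. 1 \<le> i \<and> i < 2 \<and> u i = s}) = rear [] s" for s
  proof -
    have "card {i. 1 \<le> i \<and> i < 2 \<and> u i = s} = card (if s = 0 then {1 :: nat} else {})"
      by (rule arg_cong[where f = card]) (auto simp: u_def)
    then show ?thesis by (simp add: rear_def)
  qed
  ultimately show ?thesis using \<open>arc_diagonal 1 2 h\<close> unfolding meander_levels_def one_add_one by blast
qed

text \<open>Euclid's algorithm as an induction on a + b. It stops only at a = b, where the equations
  force a = b = 1.\<close>

lemma principal_eq_levels:
  assumes "1 \<le> a" and "1 \<le> b" and "principal_eq a (a + b) h"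
  shows "meander_levels a b h"
  using assms
proof (induction "a + b" arbitrary: a b h rule: less_induct)
  case less
  \<comment> \<open>Stated for arbitrary a < b, so that it also serves the case b < a after
    exchanging the blocks.\<close>
  have smaller: "meander_levels a b h" if ab: "a < b" "1 \<le> a" "principal_eq a (a + b) h"
    and IH: "\<And>h. principal_eq a b h \<Longrightarrow> meander_levels a (b - a) h" for a b :: nat and h
    using meander_levels_step[OF ab(3,1)] IH principal_eq_step[OF ab(3,1)] by blast
  consider "a = b" | "a < b" | "b < a" by linarith
  then show ?case
  proof cases
    case 1
    then have "principal_eq a (2 * a) h" using less.prems by (simp add: mult_2)
    then show ?thesis using principal_eq_balanced less.prems 1 meander_levels_one by fastforce
  next
    case 2
    then show ?thesis using smaller[OF 2] less.hyps[of a "b - a"] less.prems by auto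
  next
    case 3
    have "principal_eq b (b + a) (\<lambda>p q. - h (a + b - 1 - q) (a + b - 1 - p))"
      using principal_eq_reverse[OF less.prems(3)] by (simp add: add.commute)
    moreover have "meander_levels b (a - b) h" if "principal_eq b a h" for h
      using less.hyps[of b "a - b" h] less.prems that 3 by auto
    ultimately show ?thesis using smaller[OF 3] less.prems meander_levels_reverse by blast
  qed
qed

theorem proposition11:
  fixes a b n :: nat and Fhat :: "complex mat"
  assumes "a \<ge> 1" and "b \<ge> 1" and "n = a + b"
    and "frobenius_algebra n (parabolic a b)"
    and "is_principal_element (parabolic a b) (meander_functional a b) Fhat"
  shows "good_grading n (\<lambda>k. ad_eigenspace n Fhat k)"
proof -
  have "meander_levels a b (\<lambda>p q. Fhat $$ (p, q))"
    using principal_eq_levels principal_element_eq assms by blast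
  then obtain w \<kappa> v where diag: "\<And>p q. p < n \<Longrightarrow> q < n \<Longrightarrow> p \<noteq> q \<Longrightarrow> Fhat $$ (p, q) = 0"
    and v: "\<And>i. i < n \<Longrightarrow> Fhat $$ (i, i) = \<kappa> + of_int (v i)"
    and front: "\<And>s. int (card {i. i < a \<and> v i = s}) = front w s"
    and rear: "\<And>s. int (card {i. a \<le> i \<and> i < n \<and> v i = s}) = rear w s"
    unfolding meander_levels_def arc_diagonal_def assms(3) by blast
  have "Fhat \<in> carrier_mat n n"
    using assms(3,5) by (auto simp: is_principal_element_def parabolic_def sl_def)
  then have eig: "ad_eigenspace n Fhat k = diag_grading n v k" for k
    using diag v by (intro ad_eigenspace_diag) auto
  \<comment> \<open>The multiplicity of a level is its count in both blocks, and the sum of the two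
    generating functions is the fence polynomial.\<close>
  have count: "int (card {i. i < n \<and> v i = s}) = fence w s" for s
  proof -
    have "{i. i < n \<and> v i = s} = {i. i < a \<and> v i = s} \<union> {i. a \<le> i \<and> i < n \<and> v i = s}"
      using assms(3) by auto
    also have "card \<dots> = card {i. i < a \<and> v i = s} + card {i. a \<le> i \<and> i < n \<and> v i = s}"
      by (intro card_Un_disjoint) auto
    finally show ?thesis using front rear by (simp add: fence_eq)
  qed
  obtain t where "unimodal (fence w) t" using fence_unimodal by blast
  then have "unimodal (\<lambda>s. card {i. i < n \<and> v i = s}) t"
    unfolding unimodal_def count[symmetric] of_nat_le_iff .
  then show ?thesis unfolding eig by (rule good_grading_unimodal)
qed

end
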